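(* Let $T$ be a continuous linear operator on $\mathrm{Hol}(\mathbb{D})$. (i) If $T=C_\varphi$ is a composition operator ($C_\varphi f=f\circ\varphi$, with $\varphi$ a holomorphic self-map of $\mathbb{D}$), then $T$ is similar to a linear isometry of $\mathrm{Hol}(\mathbb{D})$ if and only if $\varphi$ is bijective and elliptic (i.e. has a fixed point in $\mathbb{D}$). (ii) If $T=M_m$ is a multiplication operator ($M_m f=mf$, with $m\in\mathrm{Hol}(\mathbb{D})$), then $T$ is similar to a linear isometry of $\mathrm{Hol}(\mathbb{D})$ if and only if $m$ is constant and unimodular. (iii) If $T=W_{m,\varphi}$ is a weighted composition operator ($W_{m,\varphi}f=m\,(f\circ\varphi)$, with $m\in\mathrm{Hol}(\mathbb{D})$ and $\varphi$ a holomorphic self-map of $\mathbb{D}$), then $T$ is similar to a linear isometry of $\mathrm{Hol}(\mathbb{D})$ if and only if $\varphi$ is bijective and elliptic and $\sigma_p(W_{m,\varphi})\cap\mathbb{T}\neq\varnothing$.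
   Context: $\mathbb{D}$ is the open unit disc, $\mathbb{T}$ the unit circle, and $\mathrm{Hol}(\mathbb{D})$ the Fréchet space of holomorphic functions on $\mathbb{D}$ with seminorms $\|f\|_{\infty,1-1/p}=\sup_{|z|\le 1-1/p}|f(z)|$, $p\in\mathbb{N}$, and metric $d(f,g)=\sum_{p\ge1}2^{-p}\min(1,\|f-g\|_{\infty,1-1/p})$. A linear isometry of $\mathrm{Hol}(\mathbb{D})$ is a linear operator that is an isometry for $d$ (equivalently, preserves every seminorm $\|\cdot\|_{\infty,1-1/p}$). $\mathcal{L}(\mathrm{Hol}(\mathbb{D}))$ denotes the continuous linear operators on $\mathrm{Hol}(\mathbb{D})$; two operators $T,V\in\mathcal{L}(\mathrm{Hol}(\mathbb{D}))$ are similar if there is an invertible $U\in\mathcal{L}(\mathrm{Hol}(\mathbb{D}))$ with $U^{-1}TU=V$. $\sigma_p(W)$ is the point spectrum: the set of $\lambda\in\mathbb{C}$ such that $Wf=\lambda f$ for some nonzero $f\in\mathrm{Hol}(\mathbb{D})$. *)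

theory Defs
  imports "HOL-Analysis.Analysis"
begin

text \<open>Hol(D) is represented by canonical representatives: functions holomorphic on the
open unit disc that vanish outside it.\<close>

definition HolD :: "(complex \<Rightarrow> complex) set" where
  "HolD = {f. f holomorphic_on ball 0 1 \<and> (\<forall>z. z \<notin> ball 0 1 \<longrightarrow> f z = 0)}"

definition hol_seminorm :: "nat \<Rightarrow> (complex \<Rightarrow> complex) \<Rightarrow> real" where
  "hol_seminorm p f = (SUP z\<in>cball 0 (1 - 1 / real p). cmod (f z))"

definition hol_dist :: "(complex \<Rightarrow> complex) \<Rightarrow> (complex \<Rightarrow> complex) \<Rightarrow> real" where
  "hol_dist f g = (\<Sum>p. (1/2) ^ Suc p * min 1 (hol_seminorm (Suc p) (f - g)))"

definition linear_on_HolD :: "((complex \<Rightarrow> complex) \<Rightarrow> (complex \<Rightarrow> complex)) \<Rightarrow> bool" where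
  "linear_on_HolD T \<longleftrightarrow> (\<forall>f\<in>HolD. T f \<in> HolD) \<and>
     (\<forall>f\<in>HolD. \<forall>g\<in>HolD. \<forall>a b::complex. T (\<lambda>z. a * f z + b * g z) = (\<lambda>z. a * T f z + b * T g z))"

definition cont_lin_HolD :: "((complex \<Rightarrow> complex) \<Rightarrow> (complex \<Rightarrow> complex)) \<Rightarrow> bool" where
  "cont_lin_HolD T \<longleftrightarrow> linear_on_HolD T \<and>
     (\<forall>f\<in>HolD. \<forall>e>0. \<exists>d>0. \<forall>g\<in>HolD. hol_dist f g < d \<longrightarrow> hol_dist (T f) (T g) < e)"

definition lin_isometry_HolD :: "((complex \<Rightarrow> complex) \<Rightarrow> (complex \<Rightarrow> complex)) \<Rightarrow> bool" where
  "lin_isometry_HolD V \<longleftrightarrow> linear_on_HolD V \<and>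
     (\<forall>f\<in>HolD. \<forall>g\<in>HolD. hol_dist (V f) (V g) = hol_dist f g)"

definition similar_HolD :: "((complex \<Rightarrow> complex) \<Rightarrow> (complex \<Rightarrow> complex)) \<Rightarrow>
    ((complex \<Rightarrow> complex) \<Rightarrow> (complex \<Rightarrow> complex)) \<Rightarrow> bool" where
  "similar_HolD T V \<longleftrightarrow> cont_lin_HolD T \<and> cont_lin_HolD V \<and>
     (\<exists>U W. cont_lin_HolD U \<and> cont_lin_HolD W \<and>
        (\<forall>f\<in>HolD. W (U f) = f \<and> U (W f) = f) \<and>
        (\<forall>f\<in>HolD. W (T (U f)) = V f))"

definition similar_to_isometry :: "((complex \<Rightarrow> complex) \<Rightarrow> (complex \<Rightarrow> complex)) \<Rightarrow> bool" where
  "similar_to_isometry T \<longleftrightarrow> (\<exists>V. lin_isometry_HolD V \<and> similar_HolD T V)"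

definition holo_selfmap :: "(complex \<Rightarrow> complex) \<Rightarrow> bool" where
  "holo_selfmap \<phi> \<longleftrightarrow> \<phi> holomorphic_on ball 0 1 \<and> \<phi> ` ball 0 1 \<subseteq> ball 0 1"

definition elliptic :: "(complex \<Rightarrow> complex) \<Rightarrow> bool" where
  "elliptic \<phi> \<longleftrightarrow> (\<exists>z\<in>ball 0 1. \<phi> z = z)"

definition comp_op :: "(complex \<Rightarrow> complex) \<Rightarrow> (complex \<Rightarrow> complex) \<Rightarrow> (complex \<Rightarrow> complex)" where
  "comp_op \<phi> f = (\<lambda>z. if z \<in> ball 0 1 then f (\<phi> z) else 0)"

definition mult_op :: "(complex \<Rightarrow> complex) \<Rightarrow> (complex \<Rightarrow> complex) \<Rightarrow> (complex \<Rightarrow> complex)" where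
  "mult_op m f = (\<lambda>z. if z \<in> ball 0 1 then m z * f z else 0)"

definition wcomp_op :: "(complex \<Rightarrow> complex) \<Rightarrow> (complex \<Rightarrow> complex) \<Rightarrow> (complex \<Rightarrow> complex) \<Rightarrow> (complex \<Rightarrow> complex)" where
  "wcomp_op m \<phi> f = (\<lambda>z. if z \<in> ball 0 1 then m z * f (\<phi> z) else 0)"

definition point_spectrum :: "((complex \<Rightarrow> complex) \<Rightarrow> (complex \<Rightarrow> complex)) \<Rightarrow> complex set" where
  "point_spectrum W = {c. \<exists>f\<in>HolD. f \<noteq> (\<lambda>_. 0) \<and> W f = (\<lambda>z. c * f z)}"

end

theory Submission
  imports Defs "HOL-Complex_Analysis.Complex_Analysis"
begin

text \<open>Linear isometries preserve every seminorm and are therefore of the form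
  \<open>V f z = \<alpha> * f (\<beta> * z)\<close> with unimodular \<open>\<alpha>\<close>, \<open>\<beta>\<close>. If a weighted composition operator
  \<open>T = U V U\<^sup>-\<^sup>1\<close> is similar to such a \<open>V\<close>, then \<open>\<alpha>\<close> is an eigenvalue of \<open>T\<close>, the surjectivity
  of \<open>T\<close> makes \<open>\<phi>\<close> an automorphism, and the equicontinuity of the powers of \<open>T\<close> keeps the orbit of
  \<open>0\<close> under \<open>\<phi>\<close> in a compact subset of the disc, so that \<open>\<phi>\<close> is elliptic. Conversely, after
  conjugation \<open>\<phi>\<close> is a rotation \<open>z \<mapsto> \<beta> * z\<close>, and an eigenfunction for a unimodular eigenvalue yields
  a zero-free \<open>g\<close> with \<open>m z * g (\<beta> * z) = c * g z\<close>; multiplication by \<open>g\<close> conjugates \<open>T\<close> to the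
  isometry \<open>f \<mapsto> c * f (\<beta> * z)\<close>. The other two cases are the weights \<open>m = 1\<close> and the maps
  \<open>\<phi> = id\<close>.\<close>

subsection \<open>Seminorms and continuous operators on the space of holomorphic functions\<close>

text \<open>The metric truncates each seminorm at 1, so preserving it gives information on seminorms
  only through scaling: the distances of \<open>t f\<close> from 0, for all \<open>t > 0\<close>,
  determine every seminorm of \<open>f\<close>. In the form of \<open>V\<close>, seminorm 1 is the
  modulus at 0 and seminorm 2 concerns the disc of radius 1/2, whose boundary circle is enough by
  the identity theorem. The obstacle in the converse is that an eigenfunction may have zeros and
  then cannot serve as an invertible multiplier. If \<beta> is not a root of unity, zeros off the
  origin would accumulate on a circle, so only a zero at 0 has to be divided out. If \<beta> is a
  root of unity, zeros elsewhere are possible; the eigenfunction then serves only to show that the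
  product of \<open>m\<close> along a cycle is constant, and a new one is built from a logarithm of
  \<open>m\<close>. Ellipticity rests on the trace: for an automorphism given by a matrix of
  determinant 1 that moves 0, a trace of modulus at least 2 drives the orbit of 0 to the
  circle.\<close>

definition disc_restrict :: "(complex \<Rightarrow> complex) \<Rightarrow> complex \<Rightarrow> complex" where
  "disc_restrict h = (\<lambda>z. if z \<in> ball 0 1 then h z else 0)"

lemma disc_restrict_apply [simp]: "cmod z < 1 \<Longrightarrow> disc_restrict h z = h z"
  by (simp add: disc_restrict_def)

lemma HolD_disc_restrict [intro]:
  assumes "h holomorphic_on ball 0 1" shows "disc_restrict h \<in> HolD"
proof -
  have "disc_restrict h holomorphic_on ball 0 1"
    by (rule holomorphic_transform [OF assms]) (simp add: disc_restrict_def)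
  then show ?thesis by (simp add: HolD_def disc_restrict_def)
qed

lemma HolD_holomorphic: "f \<in> HolD \<Longrightarrow> f holomorphic_on ball 0 1"
  by (simp add: HolD_def)

lemma HolD_eqI:
  assumes "f \<in> HolD" "g \<in> HolD" "\<And>z. cmod z < 1 \<Longrightarrow> f z = g z"
  shows "f = g"
proof
  fix z show "f z = g z"
    using assms by (cases "cmod z < 1") (auto simp: HolD_def)
qed

lemma HolD_lincomb: "f \<in> HolD \<Longrightarrow> g \<in> HolD \<Longrightarrow> (\<lambda>z. a * f z + b * g z) \<in> HolD"
  by (auto simp: HolD_def intro!: holomorphic_intros)

lemma HolD_cmult: "f \<in> HolD \<Longrightarrow> (\<lambda>z. a * f z) \<in> HolD"
  by (auto simp: HolD_def intro!: holomorphic_intros)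

lemma HolD_zero: "(\<lambda>_. 0) \<in> HolD"
  by (auto simp: HolD_def)

lemma HolD_diff: "f \<in> HolD \<Longrightarrow> g \<in> HolD \<Longrightarrow> f - g \<in> HolD"
  using HolD_lincomb[of f g 1 "-1"] by (simp add: fun_diff_def)

text \<open>Positivity of \<open>p\<close> matters: since \<open>1 / real 0 = 0\<close>, the index 0
  would give the closed unit disc, on which a function of \<open>HolD\<close> may be
  unbounded.\<close>

lemma cball_subset_unit_ball: "0 < p \<Longrightarrow> cball (0::complex) (1 - 1 / real p) \<subseteq> ball 0 1"
proof
  fix z :: complex assume "0 < p" "z \<in> cball 0 (1 - 1 / real p)"
  moreover from this have "1 - 1 / real p < 1" by simp
  ultimately show "z \<in> ball 0 1" by (metis mem_ball_0 mem_cball_0 order_le_less_trans)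
qed

lemma seminorm_image_compact:
  assumes "f \<in> HolD" "0 < p"
  shows "compact ((\<lambda>z. cmod (f z)) ` cball 0 (1 - 1 / real p))"
    and "(\<lambda>z. cmod (f z)) ` cball 0 (1 - 1 / real p) \<noteq> {}"
proof -
  have "continuous_on (cball 0 (1 - 1 / real p)) f"
    using HolD_holomorphic[OF assms(1)] cball_subset_unit_ball[OF assms(2)]
    by (meson continuous_on_subset holomorphic_on_imp_continuous_on)
  then show "compact ((\<lambda>z. cmod (f z)) ` cball 0 (1 - 1 / real p))"
    by (intro compact_continuous_image continuous_intros) auto
  show "(\<lambda>z. cmod (f z)) ` cball 0 (1 - 1 / real p) \<noteq> {}"
    using assms(2) by auto
qed

lemma seminorm_ge:
  assumes "f \<in> HolD" "0 < p" "cmod z \<le> 1 - 1 / real p"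
  shows "cmod (f z) \<le> hol_seminorm p f"
  unfolding hol_seminorm_def
  using assms seminorm_image_compact[OF assms(1,2)]
  by (intro cSUP_upper) (auto intro: compact_imp_bounded bounded_imp_bdd_above)

lemma seminorm_attained:
  assumes "f \<in> HolD" "0 < p"
  obtains z where "cmod z \<le> 1 - 1 / real p" "cmod (f z) = hol_seminorm p f"
proof -
  have "hol_seminorm p f \<in> (\<lambda>z. cmod (f z)) ` cball 0 (1 - 1 / real p)"
    unfolding hol_seminorm_def
    using seminorm_image_compact[OF assms]
    by (intro closed_contains_Sup) (auto intro: compact_imp_bounded bounded_imp_bdd_above compact_imp_closed)
  then show ?thesis using that by auto
qed

lemma seminorm_le:
  assumes "0 < p" "\<And>z. cmod z \<le> 1 - 1 / real p \<Longrightarrow> cmod (f z) \<le> B"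
  shows "hol_seminorm p f \<le> B"
  unfolding hol_seminorm_def
  using assms by (intro cSUP_least) auto

lemma seminorm_nonneg: "f \<in> HolD \<Longrightarrow> 0 < p \<Longrightarrow> 0 \<le> hol_seminorm p f"
  by (metis norm_ge_zero seminorm_attained)

lemma seminorm_mono:
  assumes "f \<in> HolD" "0 < p" "p \<le> q"
  shows "hol_seminorm p f \<le> hol_seminorm q f"
proof (rule seminorm_le [OF assms(2)])
  fix z :: complex assume "cmod z \<le> 1 - 1 / real p"
  also have "\<dots> \<le> 1 - 1 / real q" using assms by (simp add: field_simps)
  finally show "cmod (f z) \<le> hol_seminorm q f"
    using assms by (intro seminorm_ge) auto
qed

lemma seminorm_cmult:
  assumes "f \<in> HolD" "0 < p"
  shows "hol_seminorm p (\<lambda>z. a * f z) = cmod a * hol_seminorm p f"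
proof (rule antisym)
  show "hol_seminorm p (\<lambda>z. a * f z) \<le> cmod a * hol_seminorm p f"
    using assms by (intro seminorm_le) (auto simp: norm_mult intro!: mult_left_mono seminorm_ge)
  obtain z where "cmod z \<le> 1 - 1 / real p" "cmod (f z) = hol_seminorm p f"
    using seminorm_attained[OF assms] by blast
  then show "cmod a * hol_seminorm p f \<le> hol_seminorm p (\<lambda>z. a * f z)"
    using seminorm_ge[OF HolD_cmult[OF assms(1)] assms(2), of z a] by (simp add: norm_mult)
qed

section \<open>The metric compared with single seminorms\<close>

lemma summable_geometric_min:
  fixes a :: "nat \<Rightarrow> real"
  assumes "\<And>p. 0 \<le> a p"
  shows "summable (\<lambda>p. (1/2) ^ Suc p * min 1 (a p))"
proof (rule summable_comparison_test_ev)
  show "\<forall>\<^sub>F n in sequentially. norm ((1/2) ^ Suc n * min 1 (a n)) \<le> (1/2) ^ Suc n"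
    using assms by (auto simp: abs_mult intro!: always_eventually mult_left_le)
  show "summable (\<lambda>n. (1/2::real) ^ Suc n)"
    by (subst summable_Suc_iff) (simp add: summable_geometric)
qed

lemma hol_dist_summable:
  assumes "f \<in> HolD" "g \<in> HolD"
  shows "summable (\<lambda>p. (1/2) ^ Suc p * min 1 (hol_seminorm (Suc p) (f - g)))"
  by (intro summable_geometric_min seminorm_nonneg HolD_diff assms) auto

lemma seminorm_le_hol_dist:
  assumes "f \<in> HolD" "g \<in> HolD" "0 < p"
  shows "(1/2) ^ p * min 1 (hol_seminorm p (f - g)) \<le> hol_dist f g"
proof -
  obtain q where p: "p = Suc q" using assms(3) by (cases p) auto
  have "(\<Sum>i\<in>{q}. (1/2) ^ Suc i * min 1 (hol_seminorm (Suc i) (f - g))) \<le> hol_dist f g"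
    unfolding hol_dist_def
    by (intro sum_le_suminf hol_dist_summable assms)
       (auto intro!: mult_nonneg_nonneg seminorm_nonneg HolD_diff assms)
  then show ?thesis by (simp add: p)
qed

text \<open>The summands of the first \<open>p\<close> seminorms are dominated by the
  \<open>p\<close>-th one through monotonicity, with weights of total at most 1; the others are at
  most the geometric tail, whose sum is \<open>(1/2) ^ p\<close>.\<close>

lemma hol_dist_le_seminorm:
  assumes "f \<in> HolD" "g \<in> HolD" "0 < p"
  shows "hol_dist f g \<le> hol_seminorm p (f - g) + (1/2) ^ p"
proof -
  let ?s = "hol_seminorm p (f - g)"
  let ?t = "\<lambda>i. (1/2) ^ Suc i * ?s + (if i < p then 0 else (1/2) ^ Suc i)"
  have fg: "f - g \<in> HolD" using assms by (intro HolD_diff)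
  have geo: "(\<lambda>i. (1/2::real) ^ Suc i) sums 1" by (rule power_half_series)
  have s1: "(\<lambda>i. (1/2) ^ Suc i * ?s) sums ?s" using sums_mult2[OF geo] by simp
  have s2: "(\<lambda>i. if i < p then 0 else (1/2::real) ^ Suc i) sums ((1/2) ^ p)"
  proof -
    have "(\<lambda>i. (1/2::real)^p * (1/2) ^ Suc i) sums ((1/2) ^ p * 1)" by (rule sums_mult[OF geo])
    then have "(\<lambda>i. (if i + p < p then 0 else (1/2::real) ^ Suc (i+p))) sums ((1/2) ^ p)"
      by (simp add: power_add mult_ac)
    then show ?thesis by (subst (asm) sums_iff_shift) (simp add: sum.neutral)
  qed
  have st: "?t sums (?s + (1/2)^p)" by (rule sums_add[OF s1 s2])
  have "hol_dist f g \<le> suminf ?t"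
    unfolding hol_dist_def
  proof (rule suminf_le [OF _ hol_dist_summable[OF assms(1,2)] sums_summable[OF st]])
    fix i
    have s0: "0 \<le> ?s" by (rule seminorm_nonneg[OF fg assms(3)])
    show "(1/2) ^ Suc i * min 1 (hol_seminorm (Suc i) (f - g)) \<le> ?t i"
    proof (cases "i < p")
      case True
      then have "hol_seminorm (Suc i) (f - g) \<le> ?s" by (intro seminorm_mono fg) auto
      then show ?thesis using True by (simp add: mult_left_mono)
    next
      case False
      have "(1/2::real) ^ Suc i * min 1 (hol_seminorm (Suc i) (f - g)) \<le> (1/2) ^ Suc i"
        by (intro mult_left_le) auto
      moreover have "0 \<le> (1/2::real) ^ Suc i * ?s" using s0 by simp
      ultimately show ?thesis unfolding if_not_P[OF False] by linarith
    qed
  qed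
  then show ?thesis using sums_unique[OF st] by simp
qed

lemma linear_on_HolD_D:
  assumes "linear_on_HolD T"
  shows "f \<in> HolD \<Longrightarrow> T f \<in> HolD"
    and "f \<in> HolD \<Longrightarrow> g \<in> HolD \<Longrightarrow> T (\<lambda>z. a * f z + b * g z) = (\<lambda>z. a * T f z + b * T g z)"
    and "f \<in> HolD \<Longrightarrow> T (\<lambda>z. a * f z) = (\<lambda>z. a * T f z)"
    and "f \<in> HolD \<Longrightarrow> g \<in> HolD \<Longrightarrow> T (f - g) = T f - T g"
    and "T (\<lambda>_. 0) = (\<lambda>_. 0)"
proof -
  show 1: "f \<in> HolD \<Longrightarrow> T f \<in> HolD" for f using assms by (simp add: linear_on_HolD_def)
  show 2: "f \<in> HolD \<Longrightarrow> g \<in> HolD \<Longrightarrow> T (\<lambda>z. a * f z + b * g z) = (\<lambda>z. a * T f z + b * T g z)" for f g a b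
    using assms by (simp add: linear_on_HolD_def)
  show 3: "f \<in> HolD \<Longrightarrow> T (\<lambda>z. a * f z) = (\<lambda>z. a * T f z)" for f a
    using 2[of f f a 0] by simp
  show "f \<in> HolD \<Longrightarrow> g \<in> HolD \<Longrightarrow> T (f - g) = T f - T g"
    using 2[of f g 1 "-1"] by (simp add: fun_diff_def)
  show "T (\<lambda>_. 0) = (\<lambda>_. 0)" using 3[OF HolD_zero, of 0] by simp
qed

text \<open>Continuity at 0 yields a seminorm ball whose image has \<open>q\<close>-seminorm below
  1; homogeneity turns this inclusion into a linear bound.\<close>

lemma cont_lin_HolD_bound:
  assumes "cont_lin_HolD T" "0 < q"
  obtains p C where "0 < p" "0 < C" "\<And>f. f \<in> HolD \<Longrightarrow> hol_seminorm q (T f) \<le> C * hol_seminorm p f"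
proof -
  have lin: "linear_on_HolD T" using assms by (simp add: cont_lin_HolD_def)
  note T = linear_on_HolD_D[OF lin]
  have "(1/2::real)^q > 0" by simp
  then obtain d where d: "d > 0"
    and cont: "\<And>g. g \<in> HolD \<Longrightarrow> hol_dist (\<lambda>_. 0) g < d \<Longrightarrow> hol_dist (T (\<lambda>_. 0)) (T g) < (1/2)^q"
    using assms(1) HolD_zero unfolding cont_lin_HolD_def by meson
  have neg: "(\<lambda>_. 0) - g = (\<lambda>z. (-1) * g z)" for g :: "complex \<Rightarrow> complex" by auto
  \<comment> \<open>Half of \<open>d\<close> is left for the geometric tail and half for the
    \<open>p\<close>-seminorm; passing to \<open>Suc p0\<close> makes the index positive.\<close>
  obtain p0 where p0: "(1/2::real)^p0 < d/2" using d real_arch_pow_inv[of "d/2" "1/2"] by auto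
  define p where "p = Suc p0"
  have "(1/2::real)^p \<le> (1/2)^p0" unfolding p_def by (intro power_decreasing) auto
  with p0 have p: "0 < p" "(1/2::real)^p < d/2" unfolding p_def by (blast, linarith)
  have small: "hol_seminorm q (T g) < 1" if g: "g \<in> HolD" "hol_seminorm p g < d/2" for g
  proof -
    have "hol_dist (\<lambda>_. 0) g \<le> hol_seminorm p ((\<lambda>_. 0) - g) + (1/2)^p"
      by (rule hol_dist_le_seminorm[OF HolD_zero g(1) p(1)])
    also have "hol_seminorm p ((\<lambda>_. 0) - g) = hol_seminorm p g"
      unfolding neg by (subst seminorm_cmult) (use g p in auto)
    finally have "hol_dist (T (\<lambda>_. 0)) (T g) < (1/2)^q" using cont[OF g(1)] p g(2) by simp
    moreover have "(1/2) ^ q * min 1 (hol_seminorm q ((\<lambda>_. 0) - T g)) \<le> hol_dist (T (\<lambda>_. 0)) (T g)"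
      unfolding T(5) by (rule seminorm_le_hol_dist[OF HolD_zero T(1)[OF g(1)] assms(2)])
    moreover have "hol_seminorm q ((\<lambda>_. 0) - T g) = hol_seminorm q (T g)"
      unfolding neg by (subst seminorm_cmult) (use T(1)[OF g(1)] assms(2) in auto)
    ultimately have "(1/2) ^ q * min 1 (hol_seminorm q (T g)) < (1/2::real) ^ q * 1" by simp
    then have "min 1 (hol_seminorm q (T g)) < 1" by (subst (asm) mult_less_cancel_left_pos) auto
    then show ?thesis by auto
  qed
  have "hol_seminorm q (T f) \<le> (4/d) * hol_seminorm p f" if f: "f \<in> HolD" for f
  proof (rule field_le_epsilon)
    fix e :: real assume e: "0 < e"
    \<comment> \<open>The term with \<open>e\<close> keeps the divisor positive when the seminorm of
      \<open>f\<close> vanishes. Scaling by \<open>t\<close> brings that seminorm to at most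
      \<open>d / 4\<close>, and \<open>1 / t\<close> is the desired bound with error exactly
      \<open>e\<close>.\<close>
    define c where "c = hol_seminorm p f + e * d / 4"
    have c: "c > 0" using seminorm_nonneg[OF f p(1)] e d by (simp add: c_def add_nonneg_pos)
    define t where "t = d / 4 / c"
    have t: "t > 0" using c d by (simp add: t_def)
    have "hol_seminorm p (\<lambda>z. of_real t * f z) = t * hol_seminorm p f"
      using seminorm_cmult[OF f p(1)] t by simp
    also have "\<dots> \<le> t * c" using t e d by (intro mult_left_mono) (auto simp: c_def)
    also have "\<dots> < d/2" using c d by (simp add: t_def)
    finally have "hol_seminorm q (T (\<lambda>z. of_real t * f z)) < 1"
      using small[OF HolD_cmult[OF f]] by blast
    then have "t * hol_seminorm q (T f) < 1"
      using T(3)[OF f] seminorm_cmult[OF T(1)[OF f] assms(2)] t by simp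
    then have "hol_seminorm q (T f) < 1 / t" using t by (simp add: field_simps)
    also have "1 / t = 4/d * hol_seminorm p f + e" using c d by (simp add: t_def c_def field_simps)
    finally show "hol_seminorm q (T f) \<le> 4/d * hol_seminorm p f + e" by simp
  qed
  then show ?thesis using that[of p "4/d"] p d by auto
qed

lemma cont_lin_HolD_I:
  assumes lin: "linear_on_HolD T"
    and bd: "\<And>q. 0 < q \<Longrightarrow> \<exists>p>0. \<exists>C>0. \<forall>f\<in>HolD. hol_seminorm q (T f) \<le> C * hol_seminorm p f"
  shows "cont_lin_HolD T"
  unfolding cont_lin_HolD_def
proof (intro conjI lin ballI allI impI)
  note T = linear_on_HolD_D[OF lin]
  fix f and e :: real assume f: "f \<in> HolD" and e: "0 < e"
  obtain q0 where q0: "(1/2::real)^q0 < e/2" using e real_arch_pow_inv[of "e/2" "1/2"] by auto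
  define q where "q = Suc q0"
  have "(1/2::real)^q \<le> (1/2)^q0" unfolding q_def by (intro power_decreasing) auto
  with q0 have q: "0 < q" "(1/2::real)^q < e/2" unfolding q_def by (blast, linarith)
  obtain p C where pC: "p > 0" "C > 0"
    and le: "\<And>f. f \<in> HolD \<Longrightarrow> hol_seminorm q (T f) \<le> C * hol_seminorm p f"
    using bd[OF q(1)] by blast
  define d where "d = (1/2)^p * min 1 (e / (2 * C))"
  have "d > 0" using e pC by (simp add: d_def)
  moreover have "hol_dist (T f) (T g) < e" if g: "g \<in> HolD" and d: "hol_dist f g < d" for g
  proof -
    have fg: "f - g \<in> HolD" using f g by (rule HolD_diff)
    have "(1/2) ^ p * min 1 (hol_seminorm p (f - g)) < (1/2)^p * min 1 (e / (2 * C))"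
      using seminorm_le_hol_dist[OF f g pC(1)] d unfolding d_def by linarith
    then have "min 1 (hol_seminorm p (f - g)) < min 1 (e / (2 * C))"
      by (subst (asm) mult_less_cancel_left_pos) auto
    then have "hol_seminorm p (f - g) < e / (2 * C)" by (auto simp: min_def split: if_splits)
    then have "C * hol_seminorm p (f - g) < e / 2" using pC by (simp add: field_simps)
    then have "hol_seminorm q (T f - T g) < e / 2"
      using le[OF fg] T(4)[OF f g] by simp
    moreover have "hol_dist (T f) (T g) \<le> hol_seminorm q (T f - T g) + (1/2)^q"
      by (rule hol_dist_le_seminorm[OF T(1)[OF f] T(1)[OF g] q(1)])
    ultimately show ?thesis using q by linarith
  qed
  ultimately show "\<exists>d>0. \<forall>g\<in>HolD. hol_dist f g < d \<longrightarrow> hol_dist (T f) (T g) < e" by blast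
qed

lemma lin_isometry_cont: "lin_isometry_HolD V \<Longrightarrow> cont_lin_HolD V"
  unfolding lin_isometry_HolD_def cont_lin_HolD_def by metis

section \<open>Continuity of weighted composition operators\<close>

lemma compact_unit_ball_radius:
  assumes "compact K" "K \<subseteq> ball (0::complex) 1"
  obtains p where "0 < p" "K \<subseteq> cball 0 (1 - 1 / real p)"
proof -
  obtain r where r: "r < 1" "\<And>z. z \<in> K \<Longrightarrow> cmod z \<le> r"
  proof (cases "K = {}")
    case True then show ?thesis using that[of 0] by auto
  next
    case False
    obtain w where "w \<in> K" "\<And>z. z \<in> K \<Longrightarrow> cmod z \<le> cmod w"
      using continuous_attains_sup[OF assms(1) False, of cmod] by (auto intro: continuous_intros)
    then show ?thesis using that[of "cmod w"] assms(2) by auto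
  qed
  obtain p where p: "inverse (real (Suc p)) < 1 - r" using reals_Archimedean[of "1 - r"] r by auto
  have "K \<subseteq> cball 0 (1 - 1 / real (Suc p))"
    using r p by (force simp: inverse_eq_divide)
  then show ?thesis using that[of "Suc p"] by auto
qed

lemma holo_selfmap_less: "holo_selfmap \<psi> \<Longrightarrow> cmod z < 1 \<Longrightarrow> cmod (\<psi> z) < 1"
  by (force simp: holo_selfmap_def image_subset_iff)

lemma wcomp_op_HolD:
  assumes "u holomorphic_on ball 0 1" "holo_selfmap \<psi>" "f \<in> HolD"
  shows "wcomp_op u \<psi> f \<in> HolD"
proof -
  have "(\<lambda>z. u z * f (\<psi> z)) holomorphic_on ball 0 1"
    using assms holomorphic_on_compose_gen[of \<psi> "ball 0 1" f "ball 0 1"]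
    by (intro holomorphic_intros) (auto simp: holo_selfmap_def HolD_holomorphic o_def)
  from HolD_disc_restrict[OF this] show ?thesis by (simp add: disc_restrict_def wcomp_op_def)
qed

text \<open>The self-map sends the closed disc of index \<open>q\<close> to a compact subset of the
  open disc, hence into the closed disc of some index \<open>p\<close>; the weight is bounded on the
  former.\<close>

lemma wcomp_op_cont_lin:
  assumes "u holomorphic_on ball 0 1" "holo_selfmap \<psi>"
  shows "cont_lin_HolD (wcomp_op u \<psi>)"
proof (rule cont_lin_HolD_I)
  show "linear_on_HolD (wcomp_op u \<psi>)"
    unfolding linear_on_HolD_def
    using wcomp_op_HolD[OF assms] by (auto simp: wcomp_op_def fun_eq_iff algebra_simps)
  fix q :: nat assume q: "0 < q"
  let ?K = "cball (0::complex) (1 - 1 / real q)"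
  have K: "?K \<subseteq> ball 0 1" by (rule cball_subset_unit_ball[OF q])
  have "continuous_on ?K \<psi>"
    using assms(2) K unfolding holo_selfmap_def
    by (meson continuous_on_subset holomorphic_on_imp_continuous_on)
  then have "compact (\<psi> ` ?K)" by (intro compact_continuous_image) auto
  moreover have "\<psi> ` ?K \<subseteq> ball 0 1" using assms(2) K unfolding holo_selfmap_def by blast
  ultimately obtain p where p: "0 < p" "\<psi> ` ?K \<subseteq> cball 0 (1 - 1 / real p)"
    using compact_unit_ball_radius by blast
  define C where "C = hol_seminorm q (disc_restrict u) + 1"
  have uH: "disc_restrict u \<in> HolD" using assms by blast
  have C: "C > 0" using seminorm_nonneg[OF uH q] by (simp add: C_def)
  have "hol_seminorm q (wcomp_op u \<psi> f) \<le> C * hol_seminorm p f" if f: "f \<in> HolD" for f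
  proof (rule seminorm_le[OF q])
    fix z :: complex assume z: "cmod z \<le> 1 - 1 / real q"
    then have z1: "cmod z < 1" using K by auto
    have "cmod (u z) \<le> C" using seminorm_ge[OF uH q z] z1 by (simp add: C_def)
    moreover have "cmod (f (\<psi> z)) \<le> hol_seminorm p f"
    proof (rule seminorm_ge[OF f p(1)])
      have "\<psi> z \<in> \<psi> ` ?K" using z by auto
      then show "cmod (\<psi> z) \<le> 1 - 1 / real p" using p(2) by (meson mem_cball_0 subsetD)
    qed
    ultimately show "cmod (wcomp_op u \<psi> f z) \<le> C * hol_seminorm p f"
      using z1 C by (simp add: wcomp_op_def norm_mult mult_mono)
  qed
  then show "\<exists>p>0. \<exists>C>0. \<forall>f\<in>HolD. hol_seminorm q (wcomp_op u \<psi> f) \<le> C * hol_seminorm p f"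
    using p C by blast
qed

subsection \<open>The form of linear isometries\<close>

text \<open>The weights sum to 1, so the total is 1 only if every minimum equals 1; by monotonicity
  the first entry decides.\<close>

lemma suminf_half_power_min_eq_1_iff:
  fixes x :: "nat \<Rightarrow> real"
  assumes "mono x" "\<And>p. 0 \<le> x p"
  shows "(\<Sum>i. (1/2) ^ Suc i * min 1 (x i)) = 1 \<longleftrightarrow> 1 \<le> x 0"
proof -
  have geo: "(\<lambda>i. (1/2::real) ^ Suc i) sums 1" by (rule power_half_series)
  have s: "summable (\<lambda>i. (1/2) ^ Suc i * min 1 (x i))"
    by (rule summable_geometric_min) (use assms in auto)
  show ?thesis
  proof
    assume L: "(\<Sum>i. (1/2) ^ Suc i * min 1 (x i)) = 1"
    show "1 \<le> x 0"
    proof (rule ccontr)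
      assume n: "\<not> 1 \<le> x 0"
      let ?d = "\<lambda>i. (1/2) ^ Suc i - (1/2) ^ Suc i * min 1 (x i)"
      have "?d sums 0" using sums_diff[OF geo summable_sums[OF s]] L by simp
      moreover have "0 \<le> ?d i" for i
        using mult_left_le[of "min 1 (x i)" "(1/2) ^ Suc i"] by simp
      ultimately have "\<forall>i. ?d i = 0"
        by (subst suminf_eq_zero_iff[symmetric]) (auto dest: sums_summable sums_unique)
      then have "?d 0 = 0" by blast
      then show False using n by simp
    qed
  next
    assume "1 \<le> x 0"
    then have "min 1 (x i) = 1" for i using monoD[OF assms(1), of 0 i] by auto
    then show "(\<Sum>i. (1/2) ^ Suc i * min 1 (x i)) = 1" using sums_unique[OF geo] by simp
  qed
qed

text \<open>A positive \<open>a\<close> is recovered from the least \<open>t\<close> with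
  \<open>1 \<le> t * a\<close>, namely \<open>1 / a\<close>; for \<open>a = 0\<close> there is no
  such \<open>t\<close>.\<close>

lemma real_eq_if_scaled_threshold_eq:
  fixes a b :: real
  assumes "0 \<le> a" "0 \<le> b" "\<And>t. 0 < t \<Longrightarrow> 1 \<le> t * a \<longleftrightarrow> 1 \<le> t * b"
  shows "a = b"
proof -
  have "a \<le> b" if "0 \<le> a" "0 \<le> b" "\<And>t. 0 < t \<Longrightarrow> 1 \<le> t * a \<longleftrightarrow> 1 \<le> t * b" for a b :: real
  proof (cases "a = 0")
    case False
    then show ?thesis using that(1) that(3)[of "1/a"] by (simp add: field_simps)
  qed (use that in auto)
  from this[of a b] this[of b a] assms show ?thesis by auto
qed

text \<open>The terms with index below \<open>p\<close> are peeled off inductively; the remaining tail attains its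
  maximal value exactly when \<open>t * a p \<ge> 1\<close>.\<close>
lemma eq_if_truncated_series_eq:
  fixes a b :: "nat \<Rightarrow> real"
  assumes a: "mono a" "\<And>p. 0 \<le> a p" and b: "mono b" "\<And>p. 0 \<le> b p"
    and eq: "\<And>t. 0 < t \<Longrightarrow>
      (\<Sum>p. (1/2) ^ Suc p * min 1 (t * a p)) = (\<Sum>p. (1/2) ^ Suc p * min 1 (t * b p))"
  shows "a p = b p"
  using assms
proof (induction p arbitrary: a b)
  case (0 a b)
  show ?case
  proof (rule real_eq_if_scaled_threshold_eq)
    fix t :: real assume t: "0 < t"
    have m: "mono (\<lambda>p. t * a p)" "mono (\<lambda>p. t * b p)" using 0 t by (auto simp: mono_def)
    show "1 \<le> t * a 0 \<longleftrightarrow> 1 \<le> t * b 0"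
      using suminf_half_power_min_eq_1_iff[OF m(1)] suminf_half_power_min_eq_1_iff[OF m(2)] 0 t by simp
  qed (use 0 in auto)
next
  case (Suc p a b)
  show ?case
  proof (rule Suc.IH[of "\<lambda>p. a (Suc p)" "\<lambda>p. b (Suc p)"])
    have z: "a 0 = b 0"
    proof (rule real_eq_if_scaled_threshold_eq)
      fix t :: real assume t: "0 < t"
      have m: "mono (\<lambda>p. t * a p)" "mono (\<lambda>p. t * b p)" using Suc.prems t by (auto simp: mono_def)
      show "1 \<le> t * a 0 \<longleftrightarrow> 1 \<le> t * b 0"
        using suminf_half_power_min_eq_1_iff[OF m(1)] suminf_half_power_min_eq_1_iff[OF m(2)] Suc.prems t by simp
    qed (use Suc.prems in auto)
    fix t :: real assume t: "0 < t"
    \<comment> \<open>What remains after the head is half a series of the same shape for the shifted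
      sequence, so the induction hypothesis applies once the heads agree.\<close>
    have split: "(\<Sum>p. (1/2) ^ Suc p * min 1 (t * c p)) =
        (1/2) * min 1 (t * c 0) + (1/2) * (\<Sum>p. (1/2) ^ Suc p * min 1 (t * c (Suc p)))"
      if "\<And>p. 0 \<le> c p" for c :: "nat \<Rightarrow> real"
    proof -
      have "summable (\<lambda>p. (1/2) ^ Suc p * min 1 (t * c p))"
        by (rule summable_geometric_min) (use that t in auto)
      from suminf_split_head[OF this]
      have "(\<Sum>p. (1/2) ^ Suc p * min 1 (t * c p)) =
        (1/2) * min 1 (t * c 0) + (\<Sum>p. (1/2) * ((1/2) ^ Suc p * min 1 (t * c (Suc p))))" by simp
      also have "(\<Sum>p. (1/2) * ((1/2) ^ Suc p * min 1 (t * c (Suc p))))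
         = (1/2) * (\<Sum>p. (1/2) ^ Suc p * min 1 (t * c (Suc p)))"
        by (rule suminf_mult) (rule summable_geometric_min, use that t in auto)
      finally show ?thesis .
    qed
    show "(\<Sum>p. (1/2) ^ Suc p * min 1 (t * a (Suc p))) = (\<Sum>p. (1/2) ^ Suc p * min 1 (t * b (Suc p)))"
      using Suc.prems(5)[OF t] split[of a] split[of b] Suc.prems z by simp
  qed (use Suc.prems in \<open>auto simp: mono_def\<close>)
qed

text \<open>By linearity, the isometry property for \<open>t f\<close> and 0 compares the truncated
  series of \<open>V f\<close> and \<open>f\<close> at every scale \<open>t\<close>. The index
  \<open>p - 1\<close> occurs because the series starts with seminorm 1.\<close>

lemma lin_isometry_seminorm:
  assumes "lin_isometry_HolD V" "f \<in> HolD" "0 < p"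
  shows "hol_seminorm p (V f) = hol_seminorm p f"
proof -
  have lin: "linear_on_HolD V" and iso: "\<And>f g. f \<in> HolD \<Longrightarrow> g \<in> HolD \<Longrightarrow> hol_dist (V f) (V g) = hol_dist f g"
    using assms by (auto simp: lin_isometry_HolD_def)
  note V = linear_on_HolD_D[OF lin]
  note Vf = V(1)[OF assms(2)]
  have d0: "hol_dist (\<lambda>z. of_real t * g z) (\<lambda>_. 0) = (\<Sum>p. (1/2) ^ Suc p * min 1 (t * hol_seminorm (Suc p) g))"
    if "g \<in> HolD" "0 < t" for t and g :: "complex \<Rightarrow> complex"
    using that by (simp add: hol_dist_def fun_diff_def seminorm_cmult)
  have "(\<lambda>p. hol_seminorm (Suc p) (V f)) (p - 1) = (\<lambda>p. hol_seminorm (Suc p) f) (p - 1)"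
  proof (rule eq_if_truncated_series_eq[where p = "p - 1" and a = "\<lambda>p. hol_seminorm (Suc p) (V f)"
        and b = "\<lambda>p. hol_seminorm (Suc p) f"])
    fix t :: real assume t: "0 < t"
    have "hol_dist (V (\<lambda>z. of_real t * f z)) (V (\<lambda>_. 0)) = hol_dist (\<lambda>z. of_real t * f z) (\<lambda>_. 0)"
      by (rule iso) (use assms in \<open>auto intro: HolD_cmult HolD_zero\<close>)
    then show "(\<Sum>p. (1/2) ^ Suc p * min 1 (t * hol_seminorm (Suc p) (V f))) =
        (\<Sum>p. (1/2) ^ Suc p * min 1 (t * hol_seminorm (Suc p) f))"
      unfolding V(3)[OF assms(2)] V(5) by (simp only: d0[OF assms(2) t] d0[OF Vf t])
  qed (use Vf assms in \<open>auto simp: mono_def intro!: seminorm_mono seminorm_nonneg\<close>)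
  then show ?thesis using assms(3) by simp
qed

lemma lin_isometryI:
  assumes "linear_on_HolD V"
    and "\<And>f p. f \<in> HolD \<Longrightarrow> 0 < p \<Longrightarrow> hol_seminorm p (V f) = hol_seminorm p f"
  shows "lin_isometry_HolD V"
  unfolding lin_isometry_HolD_def hol_dist_def
  using assms linear_on_HolD_D(4)[OF assms(1), symmetric] by (simp add: HolD_diff)

lemma HolD_le_if_seminorms_le:
  assumes "f \<in> HolD" "\<And>p. 0 < p \<Longrightarrow> hol_seminorm p f \<le> B" "cmod z < 1"
  shows "cmod (f z) \<le> B"
proof -
  obtain p where "0 < p" "{z} \<subseteq> cball 0 (1 - 1 / real p)"
    using compact_unit_ball_radius[of "{z}"] assms(3) by auto
  then show ?thesis using seminorm_ge[OF assms(1), of p z] assms(2)[of p] by auto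
qed

section \<open>Images of the constant 1 and of the identity; the general form\<close>

lemma holomorphic_rotate:
  assumes "f holomorphic_on ball 0 1" "cmod \<beta> = 1"
  shows "(\<lambda>z. f (\<beta> * z)) holomorphic_on ball 0 1"
proof -
  have "(\<lambda>z. \<beta> * z) ` ball 0 1 \<subseteq> ball 0 1" using assms(2) by (auto simp: norm_mult)
  moreover have "(\<lambda>z. \<beta> * z) holomorphic_on ball 0 1" by (intro holomorphic_intros)
  ultimately show ?thesis
    using holomorphic_on_compose_gen[OF _ assms(1), of "\<lambda>z. \<beta> * z" "ball 0 1"] by (simp add: o_def)
qed

text \<open>All seminorms of the image are at most 1, and the first one, which is the modulus at 0,
  equals 1. So the maximum modulus is attained inside the disc and the image is constant.\<close>

lemma lin_isometry_one:
  assumes V: "lin_isometry_HolD V"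
  obtains \<alpha> where "cmod \<alpha> = 1" "\<And>z. cmod z < 1 \<Longrightarrow> V (disc_restrict (\<lambda>_. 1)) z = \<alpha>"
proof -
  let ?o = "disc_restrict (\<lambda>_. 1)"
  have o: "?o \<in> HolD" by (intro HolD_disc_restrict) auto
  have Vo: "V ?o \<in> HolD" using V o by (auto simp: lin_isometry_HolD_def linear_on_HolD_def)
  have "hol_seminorm p ?o \<le> 1" if "0 < p" for p
    by (rule seminorm_le[OF that]) (auto simp: disc_restrict_def)
  then have le: "cmod (V ?o z) \<le> 1" if "cmod z < 1" for z
    by (intro HolD_le_if_seminorms_le[OF Vo _ that]) (simp add: lin_isometry_seminorm[OF V o])
  have s1: "hol_seminorm (Suc 0) f = cmod (f 0)" for f by (simp add: hol_seminorm_def)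
  have 1: "cmod (V ?o 0) = 1" using lin_isometry_seminorm[OF V o, of 1] by (simp add: s1)
  have "V ?o constant_on ball 0 1"
    using maximum_modulus_principle[of "V ?o" "ball 0 1" "ball 0 1" 0] HolD_holomorphic[OF Vo] le 1 by auto
  then obtain \<alpha> where "\<And>z. z \<in> ball 0 1 \<Longrightarrow> V ?o z = \<alpha>" by (auto simp: constant_on_def)
  then show ?thesis using that[of \<alpha>] 1 by auto
qed

text \<open>Seminorm 1 gives a zero at 0, and seminorm 2 gives a point \<open>w\<close> with
  \<open>cmod w \<le> 1/2\<close> and a value of modulus 1/2: this is equality in the Schwarz
  lemma.\<close>

lemma lin_isometry_ident:
  assumes V: "lin_isometry_HolD V"
  obtains \<gamma> where "cmod \<gamma> = 1" "\<And>z. cmod z < 1 \<Longrightarrow> V (disc_restrict (\<lambda>z. z)) z = \<gamma> * z"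
proof -
  let ?i = "disc_restrict (\<lambda>z. z)"
  have i: "?i \<in> HolD" by (intro HolD_disc_restrict) (auto intro: holomorphic_intros)
  have Vi: "V ?i \<in> HolD" using V i by (auto simp: lin_isometry_HolD_def linear_on_HolD_def)
  have "hol_seminorm p ?i \<le> 1" if "0 < p" for p
    by (rule seminorm_le[OF that]) (auto simp: disc_restrict_def)
  then have le: "cmod (V ?i z) \<le> 1" if "cmod z < 1" for z
    by (intro HolD_le_if_seminorms_le[OF Vi _ that]) (simp add: lin_isometry_seminorm[OF V i])
  have s1: "hol_seminorm (Suc 0) f = cmod (f 0)" for f by (simp add: hol_seminorm_def)
  have 0: "V ?i 0 = 0" using lin_isometry_seminorm[OF V i, of 1] by (simp add: s1)
  have "hol_seminorm 2 ?i \<le> 1/2" by (intro seminorm_le) (auto simp: disc_restrict_def)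
  moreover have "1/2 \<le> hol_seminorm 2 ?i"
    using seminorm_ge[OF i, of 2 "1/2"] by (simp add: norm_divide)
  ultimately have s2: "hol_seminorm 2 (V ?i) = 1/2" using lin_isometry_seminorm[OF V i, of 2] by simp
  obtain w where w: "cmod w \<le> 1/2" "cmod (V ?i w) = 1/2"
    using seminorm_attained[OF Vi, of 2] unfolding s2 by auto
  \<comment> \<open>The Schwarz lemma asks for a strict bound; a value of modulus 1 would make the
    function constant, against its values at 0 and \<open>w\<close>.\<close>
  have lt: "cmod (V ?i z) < 1" if z: "cmod z < 1" for z
  proof (rule ccontr)
    assume "\<not> ?thesis"
    then have "cmod (V ?i z) = 1" using le[OF z] by simp
    then have "V ?i constant_on ball 0 1"
      using maximum_modulus_principle[of "V ?i" "ball 0 1" "ball 0 1" z] HolD_holomorphic[OF Vi] le z by auto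
    then have "V ?i 0 = V ?i w" using w by (auto simp: constant_on_def)
    then show False using 0 w by auto
  qed
  have w1: "cmod w < 1" using w by simp
  note S = Schwarz_Lemma[OF HolD_holomorphic[OF Vi] 0 lt]
  have "cmod (V ?i w) \<le> cmod w" by (rule S(1)[OF _ w1])
  then have "cmod (V ?i w) = cmod w" "w \<noteq> 0" using w by auto
  then have "\<exists>\<gamma>. (\<forall>z. cmod z < 1 \<longrightarrow> V ?i z = \<gamma> * z) \<and> cmod \<gamma> = 1"
    by (intro S(3)[OF _ w1]) (use w1 in auto)
  then show ?thesis using that by blast
qed

text \<open>If \<open>f w = 0\<close> and \<open>p\<close> is the peak function at \<open>w\<close>, then \<open>|K p + s f| \<le> sqrt (K\<^sup>2 + B\<^sup>2)\<close> on the
  disc, which forces \<open>(V f) z = 0\<close> as \<open>K \<rightarrow> \<infinity>\<close>.\<close>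
lemma lin_isometry_preserves_zero:
  assumes V: "lin_isometry_HolD V"
    and \<alpha>: "cmod \<alpha> = 1" "\<And>z. cmod z < 1 \<Longrightarrow> V (disc_restrict (\<lambda>_. 1)) z = \<alpha>"
    and \<beta>: "cmod \<beta> = 1" "\<And>z. cmod z < 1 \<Longrightarrow> V (disc_restrict (\<lambda>z. z)) z = \<alpha> * \<beta> * z"
    and z: "cmod z = 1/2" and f: "f \<in> HolD" "f (\<beta> * z) = 0"
  shows "V f z = 0"
proof -
  define w where "w = \<beta> * z"
  have w: "cmod w = 1/2" using \<beta> z by (simp add: w_def norm_mult)
  have wb: "cnj w * w = 1/4"
    using complex_norm_square[of w] w by (simp add: power2_eq_square mult.commute)
  let ?o = "disc_restrict (\<lambda>_. 1)" and ?i = "disc_restrict (\<lambda>z. z)"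
  have lin: "linear_on_HolD V" using V by (simp add: lin_isometry_HolD_def)
  note VL = linear_on_HolD_D[OF lin]
  have o: "?o \<in> HolD" by (intro HolD_disc_restrict) auto
  have i: "?i \<in> HolD" by (intro HolD_disc_restrict) (auto intro: holomorphic_intros)
  \<comment> \<open>On the disc this is \<open>(1 + 4 * cnj w * u) / 2\<close>. As \<open>w\<close>
    has modulus 1/2, it peaks on the disc of radius 1/2 at \<open>w\<close>, with the value
    1.\<close>
  define pk where "pk = (\<lambda>z. 1/2 * ?o z + 2 * cnj w * ?i z)"
  have pkH: "pk \<in> HolD" unfolding pk_def by (rule HolD_lincomb[OF o i])
  have Vpk: "V pk z = \<alpha>"
  proof -
    have "V pk = (\<lambda>z. 1/2 * V ?o z + 2 * cnj w * V ?i z)"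
      unfolding pk_def by (rule VL(2)[OF o i])
    then have "V pk z = \<alpha> * (1/2 + 2 * (cnj w * (\<beta> * z)))"
      using z \<alpha>(2)[of z] \<beta>(2)[of z] by (simp add: algebra_simps)
    then show ?thesis unfolding w_def[symmetric] wb by simp
  qed
  \<comment> \<open>The parallelogram law for 1 and \<open>v\<close>, together with
    \<open>cmod (1 - v) = 2 * cmod (u - w)\<close>, gives a quadratic loss away from the
    peak.\<close>
  have pk_le: "(cmod (pk u))\<^sup>2 \<le> 1 - (cmod (u - w))\<^sup>2" if u: "cmod u \<le> 1/2" for u
  proof -
    define v where "v = 4 * cnj w * u"
    have "2 * pk u = 1 + v" using u by (simp add: pk_def v_def)
    then have "cmod (2 * pk u) = cmod (1 + v)" by simp
    then have 1: "2 * cmod (pk u) = cmod (1 + v)" by (simp add: norm_mult)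
    have "1 - v = 4 * cnj w * (w - u)" using wb by (simp add: algebra_simps v_def)
    then have "cmod (1 - v) = cmod (4 * cnj w * (w - u))" by simp
    then have 2: "2 * cmod (u - w) = cmod (1 - v)" by (simp add: norm_mult w norm_minus_commute)
    have "cmod v \<le> 1" using u by (simp add: norm_mult w v_def)
    then have 3: "(cmod v)\<^sup>2 \<le> 1" by (simp add: power_le_one)
    have "(cmod (1 + v))\<^sup>2 + (cmod (1 - v))\<^sup>2 = 2 + 2 * (cmod v)\<^sup>2"
      unfolding cmod_power2 by (simp add: algebra_simps power2_eq_square)
    then have "(2 * cmod (pk u))\<^sup>2 + (2 * cmod (u - w))\<^sup>2 \<le> 4"
      unfolding 1 2 using 3 by linarith
    then show ?thesis by (simp add: power_mult_distrib)
  qed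
  \<comment> \<open>A Lipschitz bound at the zero \<open>w\<close>: linear growth of
    \<open>f\<close> is what the quadratic loss of \<open>pk\<close> can absorb.\<close>
  obtain B where B: "B \<ge> 0" "\<And>u. cmod u \<le> 1/2 \<Longrightarrow> cmod (f u) \<le> B * cmod (u - w)"
  proof -
    let ?K = "cball (0::complex) (1/2)"
    have K: "?K \<subseteq> ball 0 1" by auto
    have "continuous_on ?K (deriv f)"
      using holomorphic_deriv[OF HolD_holomorphic[OF f(1)] open_ball] K
      by (meson continuous_on_subset holomorphic_on_imp_continuous_on)
    then have "compact (deriv f ` ?K)" by (intro compact_continuous_image) auto
    then obtain B where B: "\<And>u. u \<in> ?K \<Longrightarrow> cmod (deriv f u) \<le> B"
      using compact_imp_bounded bounded_iff by (metis imageI)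
    have "cmod (f u - f w) \<le> B * cmod (u - w)" if "cmod u \<le> 1/2" for u
    proof (rule field_differentiable_bound[of ?K])
      fix v assume v: "v \<in> ?K"
      then have "v \<in> ball 0 1" by auto
      then show "(f has_field_derivative deriv f v) (at v within ?K)"
        using holomorphic_derivI[OF HolD_holomorphic[OF f(1)] open_ball] has_field_derivative_at_within by blast
    qed (use B that w in auto)
    moreover have "0 \<le> B" using B[of 0] norm_ge_zero[of "deriv f 0"] by (simp del: norm_ge_zero)
    ultimately show ?thesis using that[of B] f(2) by (auto simp: w_def)
  qed
  define x where "x = cmod (V f z)"
  have main: "(K + x)\<^sup>2 \<le> K\<^sup>2 + B\<^sup>2" if K: "K \<ge> 0" for K :: real
  proof -
    \<comment> \<open>The unimodular factor \<open>s\<close> turns \<open>V f z\<close> into the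
      direction of \<alpha>, so that the moduli \<open>K\<close> and \<open>x\<close> add
      up.\<close>
    define s where "s = (if V f z = 0 then 1 else \<alpha> * of_real x / V f z)"
    have s: "cmod s = 1" "s * V f z = \<alpha> * of_real x"
      using \<alpha>(1) by (auto simp: s_def x_def norm_mult norm_divide)
    define h where "h = (\<lambda>u. of_real K * pk u + s * f u)"
    have hH: "h \<in> HolD" unfolding h_def by (rule HolD_lincomb[OF pkH f(1)])
    have "V h = (\<lambda>u. of_real K * V pk u + s * V f u)"
      unfolding h_def by (rule VL(2)[OF pkH f(1)])
    then have "V h z = \<alpha> * of_real (K + x)" using Vpk s by (simp add: algebra_simps)
    then have "cmod (V h z) = K + x" using \<alpha>(1) K
      by (simp only: norm_mult norm_of_real) (simp add: x_def)
    moreover have "cmod (V h z) \<le> hol_seminorm 2 (V h)"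
      using z by (intro seminorm_ge VL(1) hH) auto
    moreover have "hol_seminorm 2 (V h) = hol_seminorm 2 h" by (rule lin_isometry_seminorm[OF V hH]) auto
    moreover have "hol_seminorm 2 h \<le> sqrt (K\<^sup>2 + B\<^sup>2)"
    proof (rule seminorm_le)
      fix u :: complex assume "cmod u \<le> 1 - 1 / real 2"
      then have u: "cmod u \<le> 1/2" by simp
      define p q where "p = cmod (pk u)" and "q = cmod (u - w)"
      have pq: "p\<^sup>2 + q\<^sup>2 \<le> 1" using pk_le[OF u] by (simp add: p_def q_def)
      have "cmod (h u) \<le> cmod (of_real K * pk u) + cmod (s * f u)" unfolding h_def by (rule norm_triangle_ineq)
      also have "\<dots> \<le> K * p + B * q" using B(2)[OF u] s K by (simp add: norm_mult p_def q_def)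
      also have "\<dots> \<le> sqrt (K\<^sup>2 + B\<^sup>2)"
      proof (rule real_le_rsqrt)
        \<comment> \<open>Cauchy-Schwarz, by adding the missing square of Lagrange's
          identity.\<close>
        have "(K * p + B * q)\<^sup>2 \<le> (K * p + B * q)\<^sup>2 + (K * q - B * p)\<^sup>2" by simp
        also have "\<dots> = (K\<^sup>2 + B\<^sup>2) * (p\<^sup>2 + q\<^sup>2)" by (simp add: power2_eq_square algebra_simps)
        also have "\<dots> \<le> K\<^sup>2 + B\<^sup>2" using pq by (intro mult_left_le) auto
        finally show "(K * p + B * q)\<^sup>2 \<le> K\<^sup>2 + B\<^sup>2" .
      qed
      finally show "cmod (h u) \<le> sqrt (K\<^sup>2 + B\<^sup>2)" .
    qed auto
    ultimately have "K + x \<le> sqrt (K\<^sup>2 + B\<^sup>2)" by linarith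
    then have "(K + x)\<^sup>2 \<le> (sqrt (K\<^sup>2 + B\<^sup>2))\<^sup>2" using K by (intro power_mono) (auto simp: x_def)
    then show ?thesis by simp
  qed
  have "x = 0"
  proof (rule ccontr)
    assume "x \<noteq> 0"
    then have x: "x > 0" by (simp add: x_def)
    \<comment> \<open>For this \<open>K\<close> the cross term \<open>2 * K * x\<close> is
      \<open>2 * B\<^sup>2\<close>, which already exceeds what \<open>main\<close> allows.\<close>
    have "(B\<^sup>2 / x + x)\<^sup>2 \<le> (B\<^sup>2 / x)\<^sup>2 + B\<^sup>2" using main[of "B\<^sup>2 / x"] x by simp
    moreover have "(B\<^sup>2 / x + x)\<^sup>2 = (B\<^sup>2 / x)\<^sup>2 + 2 * B\<^sup>2 + x\<^sup>2" using x by (simp add: power2_sum)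
    moreover have "x\<^sup>2 > 0" using x by simp
    ultimately show False using zero_le_power2[of B] by linarith
  qed
  then show ?thesis by (simp add: x_def)
qed

text \<open>Subtracting the constant \<open>f (\<beta> * z)\<close> reduces the formula to functions
  vanishing at \<open>\<beta> * z\<close>. This settles the circle of radius 1/2, and the identity
  theorem extends it to the disc.\<close>

lemma lin_isometry_form:
  assumes V: "lin_isometry_HolD V"
  obtains \<alpha> \<beta> where "cmod \<alpha> = 1" "cmod \<beta> = 1"
    "\<And>f z. f \<in> HolD \<Longrightarrow> cmod z < 1 \<Longrightarrow> V f z = \<alpha> * f (\<beta> * z)"
proof -
  let ?o = "disc_restrict (\<lambda>_. 1)"
  obtain \<alpha> where \<alpha>: "cmod \<alpha> = 1" "\<And>z. cmod z < 1 \<Longrightarrow> V ?o z = \<alpha>"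
    using lin_isometry_one[OF V] by blast
  obtain \<gamma> where \<gamma>: "cmod \<gamma> = 1" "\<And>z. cmod z < 1 \<Longrightarrow> V (disc_restrict (\<lambda>z. z)) z = \<gamma> * z"
    using lin_isometry_ident[OF V] by blast
  define \<beta> where "\<beta> = \<gamma> / \<alpha>"
  have a0: "\<alpha> \<noteq> 0" using \<alpha> by auto
  have \<beta>: "cmod \<beta> = 1" "\<And>z. cmod z < 1 \<Longrightarrow> V (disc_restrict (\<lambda>z. z)) z = \<alpha> * \<beta> * z"
    using \<alpha> \<gamma> a0 by (auto simp: \<beta>_def norm_divide)
  have lin: "linear_on_HolD V" using V by (simp add: lin_isometry_HolD_def)
  note VL = linear_on_HolD_D[OF lin]
  have o: "?o \<in> HolD" by (intro HolD_disc_restrict) auto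
  have sph: "V f z = \<alpha> * f (\<beta> * z)" if f: "f \<in> HolD" and z: "cmod z = 1/2" for f z
  proof -
    let ?c = "f (\<beta> * z)"
    let ?g = "\<lambda>u. 1 * f u + (-?c) * ?o u"
    have g: "?g \<in> HolD" by (rule HolD_lincomb[OF f o])
    have "V ?g z = 0"
    proof (rule lin_isometry_preserves_zero[OF V \<alpha> \<beta> z g])
      have "cmod (\<beta> * z) < 1" using z \<beta> by (simp add: norm_mult)
      then show "?g (\<beta> * z) = 0" by simp
    qed
    moreover have "V ?g = (\<lambda>u. 1 * V f u + (-?c) * V ?o u)" by (rule VL(2)[OF f o])
    ultimately show ?thesis using \<alpha>(2)[of z] z by simp
  qed
  have "V f z = \<alpha> * f (\<beta> * z)" if f: "f \<in> HolD" and z: "cmod z < 1" for f z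
  proof -
    have "(\<lambda>z. f (\<beta> * z)) holomorphic_on ball 0 1"
      by (rule holomorphic_rotate[OF HolD_holomorphic[OF f] \<beta>(1)])
    then have hol: "(\<lambda>z. V f z - \<alpha> * f (\<beta> * z)) holomorphic_on ball 0 1"
      using HolD_holomorphic[OF VL(1)[OF f]] by (auto intro!: holomorphic_intros)
    have "(1/2::complex) islimpt sphere 0 (1/2)"
    proof (rule connected_imp_perfect)
      show "connected (sphere (0::complex) (1/2))" by (rule connected_sphere) simp
      show "sphere (0::complex) (1/2) \<noteq> {x}" for x
      proof
        assume *: "sphere (0::complex) (1/2) = {x}"
        have "1/2 \<in> sphere (0::complex) (1/2)" "-1/2 \<in> sphere (0::complex) (1/2)"
          by (auto simp: norm_divide)
        then have "(1/2::complex) = x" "-1/2 = x" unfolding * by blast+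
        then have "(1/2::complex) = -1/2" by simp
        then show False by simp
      qed
    qed (simp add: norm_divide)
    then have "V f z - \<alpha> * f (\<beta> * z) = 0"
    proof (rule analytic_continuation[OF hol open_ball connected_ball, rotated 2])
      show "sphere (0::complex) (1/2) \<subseteq> ball 0 1" by auto
      show "(1/2::complex) \<in> ball 0 1" by (simp add: norm_divide)
      fix u :: complex assume "u \<in> sphere 0 (1/2)"
      then have "cmod u = 1/2" by simp
      then show "V f u - \<alpha> * f (\<beta> * u) = 0" using sph[OF f] by simp
    qed (use z in simp)
    then show ?thesis by simp
  qed
  then show ?thesis using that \<alpha>(1) \<beta>(1) by blast
qed

subsection \<open>Zero-free eigenfunctions and conjugation to a rotation\<close>

text \<open>The product is the weight of the \<open>n\<close>-th iterate of the operator. If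
  \<open>\<beta>^n = 1\<close>, both sides carry the factor \<open>f z\<close>, which can be
  cancelled off its zeros.\<close>

lemma weight_cocycle_iterate:
  fixes m f :: "complex \<Rightarrow> complex"
  assumes "cmod \<beta> = 1" "\<And>z. cmod z < 1 \<Longrightarrow> m z * f (\<beta> * z) = l * f z" "cmod z < 1"
  shows "(\<Prod>j<n. m (\<beta>^j * z)) * f (\<beta>^n * z) = l^n * f z"
proof (induction n)
  case (Suc n)
  have "cmod (\<beta>^n * z) < 1" using assms by (simp add: norm_mult norm_power)
  then have "m (\<beta>^n * z) * f (\<beta>^Suc n * z) = l * f (\<beta>^n * z)"
    using assms(2)[of "\<beta>^n * z"] by (simp add: mult.assoc)
  then have "(\<Prod>j<Suc n. m (\<beta>^j * z)) * f (\<beta>^Suc n * z) = l * ((\<Prod>j<n. m (\<beta>^j * z)) * f (\<beta>^n * z))"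
    by (simp add: mult_ac)
  then show ?case using Suc by simp
qed simp

text \<open>Differentiating \<open>exp (K z)\<close> gives \<open>exp (K z) * deriv K z = 0\<close>,
  and the exponential has no zeros.\<close>

lemma holomorphic_constant_if_exp_constant:
  assumes "K holomorphic_on ball 0 1" "\<And>z. cmod z < 1 \<Longrightarrow> exp (K z) = c"
  obtains k where "\<And>z. cmod z < 1 \<Longrightarrow> K z = k"
proof -
  have d: "(K has_field_derivative 0) (at z within ball 0 1)" if z: "z \<in> ball 0 1" for z
  proof -
    have K: "(K has_field_derivative deriv K z) (at z)"
      using assms(1) z by (intro holomorphic_derivI) auto
    then have "((\<lambda>z. exp (K z)) has_field_derivative exp (K z) * deriv K z) (at z)"
      by (rule DERIV_fun_exp)
    moreover have "((\<lambda>z. exp (K z)) has_field_derivative 0) (at z)"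
      by (rule has_field_derivative_transform_within_open[of "\<lambda>_. c" 0 z "ball 0 1"])
        (use z assms(2) in auto)
    ultimately have "exp (K z) * deriv K z = 0" by (rule DERIV_unique)
    then show ?thesis using K by (simp add: has_field_derivative_at_within)
  qed
  have "\<exists>k. \<forall>z\<in>ball 0 1. K z = k"
    using has_field_derivative_zero_constant[OF convex_ball d] by blast
  then show ?thesis using that by auto
qed

text \<open>For \<open>\<beta> ^ N = 1\<close> write \<open>m = exp a\<close>; then \<open>b z = (\<Sum>j<N. j * a (\<beta>^j z)) / N\<close> solves
  \<open>b (\<beta> z) = b z + a z - k\<close> with a constant \<open>k\<close>, since \<open>m (\<beta>^(N-1) z) \<dots> m z\<close> is constant.\<close>
lemma zero_free_eigenfunction_root_of_unity:
  fixes m f :: "complex \<Rightarrow> complex"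
  assumes m: "m holomorphic_on ball 0 1" and f: "f holomorphic_on ball 0 1" "cmod z1 < 1" "f z1 \<noteq> 0"
    and \<beta>: "cmod \<beta> = 1" and l: "cmod l = 1"
    and eq: "\<And>z. cmod z < 1 \<Longrightarrow> m z * f (\<beta> * z) = l * f z"
    and N: "0 < N" "\<beta> ^ N = 1"
  obtains g c where "g holomorphic_on ball 0 1" "\<And>z. cmod z < 1 \<Longrightarrow> g z \<noteq> 0" "cmod c = 1"
    "\<And>z. cmod z < 1 \<Longrightarrow> m z * g (\<beta> * z) = c * g z"
proof -
  have rot: "(\<lambda>z. h (\<beta>^j * z)) holomorphic_on ball 0 1" if "h holomorphic_on ball 0 1" for h j
    by (rule holomorphic_rotate[OF that]) (simp add: \<beta> norm_power)
  define P where "P = (\<lambda>z. \<Prod>j<N. m (\<beta>^j * z))"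
  have Ph: "P holomorphic_on ball 0 1"
    unfolding P_def by (intro holomorphic_on_prod rot m)
  have P: "P z = l^N" if z: "cmod z < 1" for z
  proof (rule analytic_continuation_open[of "ball 0 1 \<inter> f -` (- {0})" "ball 0 1" P "\<lambda>_. l^N"])
    show "open (ball 0 1 \<inter> f -` (- {0}))"
      by (intro continuous_open_preimage holomorphic_on_imp_continuous_on f) auto
    fix z assume "z \<in> ball 0 1 \<inter> f -` (- {0})"
    then show "P z = l^N"
      using weight_cocycle_iterate[where m = m and f = f and n = N and z = z, OF \<beta> eq] N
      by (auto simp: P_def)
  qed (use f z Ph in auto)
  \<comment> \<open>\<open>m z\<close> is the factor with \<open>j = 0\<close> of
    \<open>P z\<close>, which equals \<open>l^N\<close>.\<close>
  have "m z \<noteq> 0" if "z \<in> ball 0 1" for z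
  proof
    assume "m z = 0"
    then have "P z = 0" unfolding P_def using N by (intro prod_zero) (auto intro!: bexI[of _ 0])
    then show False using P[of z] that l by auto
  qed
  then obtain a where a: "a holomorphic_on ball 0 1" "\<And>z. z \<in> ball 0 1 \<Longrightarrow> exp (a z) = m z"
    using holomorphic_logarithm_exists[of "ball 0 1" m 0] m by auto
  define K where "K = (\<lambda>z. \<Sum>j<N. a (\<beta>^j * z))"
  have "K holomorphic_on ball 0 1" unfolding K_def by (intro holomorphic_on_sum rot a)
  moreover have expK: "exp (K z) = l^N" if z: "cmod z < 1" for z
  proof -
    have "exp (K z) = (\<Prod>j<N. exp (a (\<beta>^j * z)))" unfolding K_def by (rule exp_sum) simp
    also have "\<dots> = P z" unfolding P_def
      using z \<beta> by (intro prod.cong a) (auto simp: norm_mult norm_power)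
    finally show ?thesis using P[OF z] by simp
  qed
  ultimately obtain k where k: "\<And>z. cmod z < 1 \<Longrightarrow> K z = k"
    using holomorphic_constant_if_exp_constant by blast
  define b where "b = (\<lambda>z. (\<Sum>j<N. of_nat j * a (\<beta>^j * z)) / of_nat N)"
  have bh: "b holomorphic_on ball 0 1" unfolding b_def using N
    by (intro holomorphic_intros rot a) auto
  have b: "b (\<beta> * z) = b z + a z - k / of_nat N" if z: "cmod z < 1" for z
  proof -
    define x where "x = (\<lambda>j. a (\<beta>^j * z))"
    have xN: "x N = x 0" using N by (simp add: x_def)
    \<comment> \<open>Applied to \<open>j * x j\<close>, the shift leaves the boundary term
      \<open>N * x N\<close>; it equals \<open>N * x 0\<close> because \<open>\<beta>^N = 1\<close>,
      and this produces the summand \<open>a z\<close>.\<close>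
    have sh: "(\<Sum>j<N. y (Suc j)) = (\<Sum>j<N. y j) + y N - y 0" for y :: "nat \<Rightarrow> complex"
      using sum.lessThan_Suc[of y N] sum.lessThan_Suc_shift[of y N] by (simp add: algebra_simps)
    have "of_nat N * b (\<beta> * z) = (\<Sum>j<N. of_nat j * x (Suc j))"
      using N by (simp add: b_def x_def mult_ac)
    also have "\<dots> = (\<Sum>j<N. of_nat (Suc j) * x (Suc j)) - (\<Sum>j<N. x (Suc j))"
      by (simp add: sum_subtractf[symmetric] algebra_simps)
    also have "\<dots> = (\<Sum>j<N. of_nat j * x j) + of_nat N * x N - (\<Sum>j<N. x j)"
      using sh[of "\<lambda>j. of_nat j * x j"] sh[of x] xN by simp
    also have "\<dots> = of_nat N * b z + of_nat N * a z - k"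
      using N k[OF z] xN by (simp add: b_def x_def K_def)
    finally show ?thesis using N by (simp add: field_simps)
  qed
  \<comment> \<open>The new eigenvalue may differ from \<open>l\<close>, but it has the same
    \<open>N\<close>-th power and is therefore unimodular.\<close>
  define c where "c = exp (k / of_nat N)"
  have "cmod c ^ N = 1"
  proof -
    have "c ^ N = exp k" unfolding c_def using N by (simp add: exp_of_nat_mult[symmetric])
    then have "c ^ N = l ^ N" using expK[of 0] k[of 0] by simp
    then show ?thesis using l by (metis norm_power power_one)
  qed
  then have "cmod c = 1" using power_eq_imp_eq_base[of "cmod c" N 1] N by simp
  moreover have "m z * exp (- b (\<beta> * z)) = c * exp (- b z)" if z: "cmod z < 1" for z
  proof -
    have "m z * exp (- b (\<beta> * z)) = exp (a z + - b (\<beta> * z))"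
      using a(2)[of z] z unfolding exp_add by simp
    also have "a z + - b (\<beta> * z) = k / of_nat N + - b z" by (simp add: b[OF z])
    finally show ?thesis by (simp only: exp_add c_def)
  qed
  moreover have "(\<lambda>z. exp (- b z)) holomorphic_on ball 0 1" using bh by (intro holomorphic_intros)
  ultimately show ?thesis using that[of "\<lambda>z. exp (- b z)" c] by simp
qed

lemma zero_free_eigenfunction_irrational:
  fixes m f :: "complex \<Rightarrow> complex"
  assumes m: "m holomorphic_on ball 0 1" and f: "f holomorphic_on ball 0 1" "cmod z1 < 1" "f z1 \<noteq> 0"
    and \<beta>: "cmod \<beta> = 1" and l: "cmod l = 1"
    and eq: "\<And>z. cmod z < 1 \<Longrightarrow> m z * f (\<beta> * z) = l * f z"
    and irr: "\<And>N. 0 < N \<Longrightarrow> \<beta> ^ N \<noteq> 1"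
  obtains g c where "g holomorphic_on ball 0 1" "\<And>z. cmod z < 1 \<Longrightarrow> g z \<noteq> 0" "cmod c = 1"
    "\<And>z. cmod z < 1 \<Longrightarrow> m z * g (\<beta> * z) = c * g z"
proof -
  have b0: "\<beta> \<noteq> 0" using \<beta> by auto
  have nz: "f z \<noteq> 0" if z: "cmod z < 1" "z \<noteq> 0" for z
  proof
    assume fz: "f z = 0"
    \<comment> \<open>The orbit is followed backwards: a zero of \<open>f\<close> at
      \<open>\<beta> * z\<close> forces one at \<open>z\<close> because \<open>l\<close> is nonzero,
      whereas going forwards would need \<open>m z \<noteq> 0\<close>.\<close>
    define \<gamma> where "\<gamma> = inverse \<beta>"
    have \<gamma>: "cmod \<gamma> = 1" using \<beta> by (simp add: \<gamma>_def norm_inverse)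
    have norm: "cmod (\<gamma>^n * z) = cmod z" for n using \<gamma> by (simp add: norm_mult norm_power)
    have zer: "f (\<gamma>^n * z) = 0" for n
    proof (induction n)
      case (Suc n)
      have e: "\<beta> * (\<gamma>^Suc n * z) = \<gamma>^n * z" using b0 by (simp add: \<gamma>_def)
      have "cmod (\<gamma>^Suc n * z) < 1" unfolding norm by (rule z)
      from eq[OF this] have "m (\<gamma>^Suc n * z) * f (\<gamma>^n * z) = l * f (\<gamma>^Suc n * z)" unfolding e .
      then show ?case using Suc l by auto
    qed (use fz in simp)
    have inj: "inj (\<lambda>n. \<gamma>^n * z)"
    proof (rule linorder_injI)
      fix i j :: nat assume ij: "i < j"
      show "\<gamma>^i * z \<noteq> \<gamma>^j * z"
      proof
        assume "\<gamma>^i * z = \<gamma>^j * z"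
        then have "\<gamma>^i = \<gamma>^(i + (j - i))" using z ij by simp
        then have "\<gamma>^(j - i) = 1" unfolding power_add using \<gamma> by auto
        then have "\<beta>^(j - i) = 1" by (simp add: \<gamma>_def power_inverse)
        then show False using irr[of "j - i"] ij by simp
      qed
    qed
    let ?Z = "range (\<lambda>n. \<gamma>^n * z)"
    have "infinite ?Z" using inj by (rule range_inj_infinite)
    moreover have "?Z \<subseteq> sphere 0 (cmod z)" using norm by auto
    ultimately obtain \<xi> where \<xi>: "\<xi> \<in> sphere 0 (cmod z)" "\<xi> islimpt ?Z"
      using compact_sphere compact_eq_Bolzano_Weierstrass by metis
    have "f z1 = 0"
      by (rule analytic_continuation[OF f(1) open_ball connected_ball, of ?Z \<xi>])
        (use \<xi> norm z zer f in auto)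
    then show False using f by simp
  qed
  show ?thesis
  proof (cases "f 0 = 0")
    case False
    have "f z \<noteq> 0" if "cmod z < 1" for z using nz[OF that] False by (cases "z = 0") auto
    then show ?thesis by (rule that[OF f(1) _ l eq])
  next
    case True
    have z01: "0 \<in> ball (0::complex) 1" by simp
    have nc: "\<not> f constant_on ball 0 1"
    proof
      assume "f constant_on ball 0 1"
      then obtain y where "\<forall>z\<in>ball 0 1. f z = y" unfolding constant_on_def by blast
      then have "f z1 = y" "f 0 = y" using f(2) by simp_all
      then show False using True f(3) by metis
    qed
    obtain g0 r n where n: "0 < n" and r: "0 < r" "ball 0 r \<subseteq> ball (0::complex) 1"
      and g0: "g0 holomorphic_on ball 0 r" "\<And>w. w \<in> ball 0 r \<Longrightarrow> f w = (w - 0)^n * g0 w"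
        "\<And>w. w \<in> ball 0 r \<Longrightarrow> g0 w \<noteq> 0"
      by (rule holomorphic_factor_zero_nonconstant[OF f(1) open_ball connected_ball z01 True nc]) (rule that)
    \<comment> \<open>The local factor \<open>g0\<close> fills the removable singularity of
      \<open>f w / w^n\<close> at 0.\<close>
    define g where "g = (\<lambda>w. if w \<in> ball 0 r then g0 w else f w / w^n)"
    have geq: "g w = f w / w^n" if "w \<noteq> 0" for w
      using g0(2)[of w] that by (auto simp: g_def)
    have fg: "f w = w^n * g w" if "cmod w < 1" for w
      using geq[of w] True n by (cases "w = 0") simp_all
    have gn: "g w \<noteq> 0" if "cmod w < 1" for w
    proof (cases "w \<in> ball 0 r")
      case True
      then show ?thesis using g0(3) by (simp add: g_def)
    next
      case False
      then have "w \<noteq> 0" using r(1) by auto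
      then show ?thesis using geq nz[OF that] by simp
    qed
    have "g holomorphic_on ball 0 r" by (rule holomorphic_transform[OF g0(1)]) (simp add: g_def)
    moreover have "(\<lambda>w. f w / w^n) holomorphic_on ball 0 1 - {0}"
      using f(1) by (intro holomorphic_intros) (auto intro: holomorphic_on_subset)
    then have "g holomorphic_on ball 0 1 - {0}"
      by (rule holomorphic_transform) (use geq in auto)
    ultimately have "g holomorphic_on ball 0 r \<union> (ball 0 1 - {0})"
      by (intro holomorphic_on_Un) auto
    then have gh: "g holomorphic_on ball 0 1" by (rule holomorphic_on_subset) (use r in auto)
    \<comment> \<open>Dividing \<open>f\<close> by the \<open>n\<close>-th power of the variable
      leaves a factor \<open>\<beta>^n\<close> at the point \<open>\<beta> * z\<close>; it is moved
      into the eigenvalue.\<close>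
    define c where "c = l / \<beta>^n"
    have "m z * g (\<beta> * z) = c * g z" if z: "cmod z < 1" for z
    proof (rule analytic_continuation_open[of "ball 0 1 - {0}" "ball 0 1"
          "\<lambda>z. m z * g (\<beta> * z)" "\<lambda>z. c * g z"])
      show "(\<lambda>z. m z * g (\<beta> * z)) holomorphic_on ball 0 1"
        by (rule holomorphic_on_mult[OF m holomorphic_rotate[OF gh \<beta>]])
      show "(\<lambda>z. c * g z) holomorphic_on ball 0 1" by (intro holomorphic_intros gh)
      have "1/2 \<in> ball (0::complex) 1 - {0}" by (auto simp: norm_divide)
      then show "ball (0::complex) 1 - {0} \<noteq> {}" by blast
      fix u :: complex assume u: "u \<in> ball 0 1 - {0}"
      have "cmod (\<beta> * u) < 1" using \<beta> u by (simp add: norm_mult)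
      then have "m u * ((\<beta> * u)^n * g (\<beta> * u)) = l * (u^n * g u)"
        using eq[of u] fg[of u] fg[of "\<beta> * u"] u by simp
      then have "u^n * (m u * (\<beta>^n * g (\<beta> * u))) = u^n * (l * g u)"
        by (simp only: power_mult_distrib mult_ac)
      then have "m u * (\<beta>^n * g (\<beta> * u)) = l * g u" using u by simp
      then show "m u * g (\<beta> * u) = c * g u"
        using b0 by (simp add: c_def eq_divide_eq mult_ac)
    qed (use z in \<open>auto intro: open_delete\<close>)
    moreover have "cmod c = 1" using l \<beta> by (simp add: c_def norm_divide norm_power)
    ultimately show ?thesis by (intro that[OF gh gn])
  qed
qed

section \<open>Disc automorphisms and conjugation of the operator\<close>

lemma holo_selfmap_comp:
  assumes "holo_selfmap \<phi>" "holo_selfmap \<psi>"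
  shows "holo_selfmap (\<lambda>z. \<phi> (\<psi> z))"
proof -
  have "(\<lambda>z. \<phi> (\<psi> z)) holomorphic_on ball 0 1"
    using assms holomorphic_on_compose_gen[of \<psi> "ball 0 1" \<phi> "ball 0 1"]
    by (simp add: holo_selfmap_def o_def)
  moreover have "cmod (\<phi> (\<psi> z)) < 1" if "cmod z < 1" for z
    by (rule holo_selfmap_less[OF assms(1) holo_selfmap_less[OF assms(2) that]])
  ultimately show ?thesis by (auto simp: holo_selfmap_def)
qed

lemma holo_selfmap_inverse:
  assumes "holo_selfmap \<phi>" "bij_betw \<phi> (ball 0 1) (ball 0 1)"
  obtains \<eta> where "holo_selfmap \<eta>" "\<And>z. cmod z < 1 \<Longrightarrow> \<eta> (\<phi> z) = z"
proof -
  have im: "\<phi> ` ball 0 1 = ball 0 1" using assms(2) by (simp add: bij_betw_def)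
  obtain \<eta> where \<eta>: "\<eta> holomorphic_on \<phi> ` ball 0 1" "\<And>z. z \<in> ball 0 1 \<Longrightarrow> \<eta> (\<phi> z) = z"
    by (rule holomorphic_has_inverse[of \<phi> "ball 0 1"])
      (use assms in \<open>simp_all add: holo_selfmap_def bij_betw_def\<close>)
  have "\<eta> ` ball 0 1 \<subseteq> ball 0 1"
  proof
    fix y assume "y \<in> \<eta> ` ball 0 1"
    then obtain u where u: "u \<in> \<phi> ` ball 0 1" "y = \<eta> u" unfolding im by blast
    then obtain x where "x \<in> ball 0 1" "u = \<phi> x" by blast
    then show "y \<in> ball 0 1" using \<eta>(2)[of x] u(2) by simp
  qed
  then have "holo_selfmap \<eta>" using \<eta>(1) im by (simp add: holo_selfmap_def)
  then show ?thesis by (rule that) (simp add: \<eta>(2))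
qed

text \<open>The Schwarz lemma for \<phi> and for its left inverse \<eta> gives opposite inequalities
  for the modulus of \<open>\<phi> (1/2)\<close>, hence the equality case.\<close>

lemma automorphism_fixing_0_rotation:
  assumes \<phi>: "holo_selfmap \<phi>" "\<phi> 0 = 0" and \<eta>: "holo_selfmap \<eta>" "\<And>z. cmod z < 1 \<Longrightarrow> \<eta> (\<phi> z) = z"
  obtains \<beta> where "cmod \<beta> = 1" "\<And>z. cmod z < 1 \<Longrightarrow> \<phi> z = \<beta> * z"
proof -
  have \<eta>0: "\<eta> 0 = 0" using \<eta>(2)[of 0] \<phi>(2) by simp
  note S\<phi> = Schwarz_Lemma[of \<phi>, OF _ \<phi>(2) holo_selfmap_less[OF \<phi>(1)]]
  note S\<eta> = Schwarz_Lemma[of \<eta>, OF _ \<eta>0 holo_selfmap_less[OF \<eta>(1)]]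
  have h: "\<phi> holomorphic_on ball 0 1" "\<eta> holomorphic_on ball 0 1" using \<phi> \<eta> by (auto simp: holo_selfmap_def)
  have half: "cmod (1/2::complex) < 1" by (simp add: norm_divide)
  have "cmod (\<phi> (1/2)) \<le> cmod (1/2)" by (rule S\<phi>(1)[OF h(1) _ half])
  moreover have "cmod (\<eta> (\<phi> (1/2))) \<le> cmod (\<phi> (1/2))"
    by (rule S\<eta>(1)[OF h(2) _ holo_selfmap_less[OF \<phi>(1) half]])
  ultimately have "cmod (\<phi> (1/2)) = cmod (1/2)" using \<eta>(2)[OF half] by simp
  then have "\<exists>z. cmod z < 1 \<and> z \<noteq> 0 \<and> cmod (\<phi> z) = cmod z" using half by (intro exI[of _ "1/2"]) auto
  then have "\<exists>\<beta>. (\<forall>z. cmod z < 1 \<longrightarrow> \<phi> z = \<beta> * z) \<and> cmod \<beta> = 1"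
    by (intro S\<phi>(3)[OF h(1) _ half]) auto
  then show ?thesis using that by blast
qed

text \<open>A disc automorphism \<kappa> that moves the fixed point to 0 turns \<phi> into an
  automorphism fixing 0.\<close>

lemma elliptic_automorphism_conjugate_rotation:
  assumes "holo_selfmap \<phi>" "bij_betw \<phi> (ball 0 1) (ball 0 1)" "elliptic \<phi>"
  obtains \<psi> \<kappa> \<beta> where "holo_selfmap \<psi>" "holo_selfmap \<kappa>" "cmod \<beta> = 1"
    "\<And>z. cmod z < 1 \<Longrightarrow> \<psi> (\<kappa> z) = z" "\<And>z. cmod z < 1 \<Longrightarrow> \<kappa> (\<psi> z) = z"
    "\<And>z. cmod z < 1 \<Longrightarrow> \<kappa> (\<phi> z) = \<beta> * \<kappa> z"
proof -
  obtain z0 where z0: "z0 \<in> ball 0 1" "\<phi> z0 = z0" using assms(3) by (auto simp: elliptic_def)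
  obtain \<kappa> \<psi> where c0: "\<kappa> z0 = 0" and s: "holo_selfmap \<kappa>" "holo_selfmap \<psi>"
    and inv: "\<And>z. z \<in> ball 0 1 \<Longrightarrow> \<kappa> (\<psi> z) = z" "\<And>z. z \<in> ball 0 1 \<Longrightarrow> \<psi> (\<kappa> z) = z"
    using ball_biholomorphism_exists[OF z0(1)] unfolding holo_selfmap_def by (metis (no_types))
  obtain \<eta> where \<eta>: "holo_selfmap \<eta>" "\<And>z. cmod z < 1 \<Longrightarrow> \<eta> (\<phi> z) = z"
    using holo_selfmap_inverse[OF assms(1,2)] by blast
  have \<psi>0: "\<psi> 0 = z0" using inv(2)[OF z0(1)] c0 by simp
  obtain \<beta> where \<beta>: "cmod \<beta> = 1" "\<And>z. cmod z < 1 \<Longrightarrow> \<kappa> (\<phi> (\<psi> z)) = \<beta> * z"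
  proof -
    have 1: "\<kappa> (\<eta> (\<psi> (\<kappa> (\<phi> (\<psi> z))))) = z" if "cmod z < 1" for z
      using that inv \<eta>(2)[of "\<psi> z"] holo_selfmap_less[OF s(2) that]
        holo_selfmap_less[OF assms(1), of "\<psi> z"] by simp
    have 2: "holo_selfmap (\<lambda>z. \<kappa> (\<phi> (\<psi> z)))"
      by (rule holo_selfmap_comp[OF s(1) holo_selfmap_comp[OF assms(1) s(2)]])
    have 3: "holo_selfmap (\<lambda>z. \<kappa> (\<eta> (\<psi> z)))"
      by (rule holo_selfmap_comp[OF s(1) holo_selfmap_comp[OF \<eta>(1) s(2)]])
    have 4: "\<kappa> (\<phi> (\<psi> 0)) = 0" using \<psi>0 z0 c0 by simp
    show ?thesis
      using automorphism_fixing_0_rotation[of "\<lambda>z. \<kappa> (\<phi> (\<psi> z))" "\<lambda>z. \<kappa> (\<eta> (\<psi> z))", OF 2 4 3 1] that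
      by blast
  qed
  have "\<kappa> (\<phi> z) = \<beta> * \<kappa> z" if "cmod z < 1" for z
    using \<beta>(2)[of "\<kappa> z"] holo_selfmap_less[OF s(1) that] inv(2)[of z] that by simp
  then show ?thesis using inv by (intro that[OF s(2,1) \<beta>(1)]) simp_all
qed

lemma rotation_lin_isometry:
  assumes "cmod c = 1" "cmod \<beta> = 1"
  shows "lin_isometry_HolD (wcomp_op (\<lambda>_. c) (\<lambda>z. \<beta> * z))" "holo_selfmap (\<lambda>z. \<beta> * z)"
proof -
  show rot: "holo_selfmap (\<lambda>z. \<beta> * z)"
    using assms by (auto simp: holo_selfmap_def norm_mult intro!: holomorphic_intros)
  let ?V = "wcomp_op (\<lambda>_. c) (\<lambda>z. \<beta> * z)"
  have cont: "cont_lin_HolD ?V" by (rule wcomp_op_cont_lin[OF _ rot]) auto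
  show "lin_isometry_HolD ?V"
  proof (rule lin_isometryI)
    show lin: "linear_on_HolD ?V" using cont by (simp add: cont_lin_HolD_def)
    fix f and p :: nat assume f: "f \<in> HolD" and p: "0 < p"
    have Vf: "?V f \<in> HolD" using linear_on_HolD_D(1)[OF lin f] .
    have less: "cmod z < 1" if "cmod z \<le> 1 - 1 / real p" for z :: complex
      using cball_subset_unit_ball[OF p] that by auto
    show "hol_seminorm p (?V f) = hol_seminorm p f"
    proof (rule antisym)
      show "hol_seminorm p (?V f) \<le> hol_seminorm p f"
      proof (rule seminorm_le[OF p])
        fix z :: complex assume z: "cmod z \<le> 1 - 1 / real p"
        have "cmod (?V f z) = cmod (f (\<beta> * z))" using assms less[OF z] by (simp add: wcomp_op_def norm_mult)
        also have "\<dots> \<le> hol_seminorm p f" using z assms by (intro seminorm_ge f p) (simp add: norm_mult)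
        finally show "cmod (?V f z) \<le> hol_seminorm p f" .
      qed
      show "hol_seminorm p f \<le> hol_seminorm p (?V f)"
      proof (rule seminorm_le[OF p])
        fix z :: complex assume z: "cmod z \<le> 1 - 1 / real p"
        have b: "\<beta> \<noteq> 0" using assms by auto
        have n: "cmod (z / \<beta>) = cmod z" using assms by (simp add: norm_divide)
        have "cmod (f z) = cmod (?V f (z / \<beta>))"
          using assms less[OF z] n b by (simp add: wcomp_op_def norm_mult)
        also have "\<dots> \<le> hol_seminorm p (?V f)" using z n by (intro seminorm_ge Vf p) simp
        finally show "cmod (f z) \<le> hol_seminorm p (?V f)" .
      qed
    qed
  qed
qed

text \<open>In the coordinate \<kappa> the eigenfunction becomes \<open>f \<circ> \<psi>\<close>,
  for the weight \<open>m \<circ> \<psi>\<close> and a rotation, so that a zero-free one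
  exists.\<close>

lemma wcomp_op_similar_to_isometry:
  assumes m: "m holomorphic_on ball 0 1" and \<phi>: "holo_selfmap \<phi>" "bij_betw \<phi> (ball 0 1) (ball 0 1)" "elliptic \<phi>"
    and ps: "point_spectrum (wcomp_op m \<phi>) \<inter> sphere 0 1 \<noteq> {}"
  shows "similar_to_isometry (wcomp_op m \<phi>)"
proof -
  obtain l f where l: "cmod l = 1" and f: "f \<in> HolD" "f \<noteq> (\<lambda>_. 0)" "wcomp_op m \<phi> f = (\<lambda>z. l * f z)"
    using ps by (auto simp: point_spectrum_def)
  obtain \<psi> \<kappa> \<beta> where s: "holo_selfmap \<psi>" "holo_selfmap \<kappa>" and \<beta>: "cmod \<beta> = 1"
    and inv: "\<And>z. cmod z < 1 \<Longrightarrow> \<psi> (\<kappa> z) = z" "\<And>z. cmod z < 1 \<Longrightarrow> \<kappa> (\<psi> z) = z"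
    and rot: "\<And>z. cmod z < 1 \<Longrightarrow> \<kappa> (\<phi> z) = \<beta> * \<kappa> z"
    using elliptic_automorphism_conjugate_rotation[OF \<phi>] by blast
  note less = holo_selfmap_less[OF s(1)] holo_selfmap_less[OF s(2)] holo_selfmap_less[OF \<phi>(1)]
  have compose: "(\<lambda>z. h (k z)) holomorphic_on ball 0 1" if "holo_selfmap k" "h holomorphic_on ball 0 1" for h k
    using that holomorphic_on_compose_gen[of k "ball 0 1" h "ball 0 1"] by (simp add: holo_selfmap_def o_def)
  have \<phi>\<psi>: "\<phi> (\<psi> z) = \<psi> (\<beta> * z)" if "cmod z < 1" for z
    using rot[of "\<psi> z"] inv(1)[of "\<phi> (\<psi> z)"] inv(2)[OF that] less(1)[OF that] less(3)[of "\<psi> z"] by simp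
  obtain z1 where z1: "cmod z1 < 1" "f z1 \<noteq> 0" using f HolD_eqI[OF f(1) HolD_zero] by blast
  have eq: "m (\<psi> z) * f (\<psi> (\<beta> * z)) = l * f (\<psi> z)" if "cmod z < 1" for z
    using fun_cong[OF f(3), of "\<psi> z"] \<phi>\<psi>[OF that] less(1)[OF that] by (simp add: wcomp_op_def)
  have mh: "(\<lambda>z. m (\<psi> z)) holomorphic_on ball 0 1" by (rule compose[OF s(1) m])
  have fh: "(\<lambda>z. f (\<psi> z)) holomorphic_on ball 0 1" by (rule compose[OF s(1) HolD_holomorphic[OF f(1)]])
  have z2: "cmod (\<kappa> z1) < 1" "f (\<psi> (\<kappa> z1)) \<noteq> 0" using z1 less(2) inv(1) by auto
  obtain g c where g: "g holomorphic_on ball 0 1" "\<And>z. cmod z < 1 \<Longrightarrow> g z \<noteq> 0" and c: "cmod c = 1"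
    and mg: "\<And>z. cmod z < 1 \<Longrightarrow> m (\<psi> z) * g (\<beta> * z) = c * g z"
  proof (cases "\<exists>N>0. \<beta> ^ N = 1")
    case True
    then obtain N where "0 < N" "\<beta> ^ N = 1" by blast
    from zero_free_eigenfunction_root_of_unity[OF mh fh z2 \<beta> l eq this] show ?thesis
      using that by blast
  next
    case False
    then have "\<beta> ^ N \<noteq> 1" if "0 < N" for N using that by blast
    from zero_free_eigenfunction_irrational[OF mh fh z2 \<beta> l eq this] show ?thesis
      using that by blast
  qed
  \<comment> \<open>\<open>?U\<close> multiplies by \<open>g\<close> and then composes with
    \<kappa>; \<open>?W\<close> composes with \<psi> and then divides by \<open>g\<close>. The
    relation \<open>mg\<close> reduces the weight of the conjugated operator to
    \<open>c\<close>.\<close>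
  let ?U = "wcomp_op (\<lambda>z. g (\<kappa> z)) \<kappa>" and ?W = "wcomp_op (\<lambda>z. 1 / g z) \<psi>"
    and ?V = "wcomp_op (\<lambda>_. c) (\<lambda>z. \<beta> * z)" and ?T = "wcomp_op m \<phi>"
  have Uh: "(\<lambda>z. g (\<kappa> z)) holomorphic_on ball 0 1" by (rule compose[OF s(2) g(1)])
  have Wh: "(\<lambda>z. 1 / g z) holomorphic_on ball 0 1" using g by (intro holomorphic_intros) auto
  have U: "cont_lin_HolD ?U" by (rule wcomp_op_cont_lin[OF Uh s(2)])
  have W: "cont_lin_HolD ?W" by (rule wcomp_op_cont_lin[OF Wh s(1)])
  note V = rotation_lin_isometry[OF c \<beta>]
  have WU: "?W (?U h) = h" if h: "h \<in> HolD" for h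
  proof (rule HolD_eqI[OF _ h])
    show "?W (?U h) \<in> HolD" by (intro wcomp_op_HolD Uh Wh s h)
    show "?W (?U h) z = h z" if "cmod z < 1" for z
      using g(2)[OF that] inv(2)[OF that] less(1)[OF that] that by (simp add: wcomp_op_def)
  qed
  have UW: "?U (?W h) = h" if h: "h \<in> HolD" for h
  proof (rule HolD_eqI[OF _ h])
    show "?U (?W h) \<in> HolD" by (intro wcomp_op_HolD Uh Wh s h)
    show "?U (?W h) z = h z" if "cmod z < 1" for z
      using g(2)[OF less(2)[OF that]] inv(1)[OF that] less(2)[OF that] that by (simp add: wcomp_op_def)
  qed
  have WTU: "?W (?T (?U h)) = ?V h" if h: "h \<in> HolD" for h
  proof (rule HolD_eqI)
    show "?W (?T (?U h)) \<in> HolD" by (intro wcomp_op_HolD Uh Wh s h m \<phi>)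
    show "?V h \<in> HolD" by (intro wcomp_op_HolD V(2) h) auto
    fix z :: complex assume z: "cmod z < 1"
    have bz: "cmod (\<beta> * z) < 1" using \<beta> z by (simp add: norm_mult)
    have "?W (?T (?U h)) z = 1 / g z * (m (\<psi> z) * (g (\<beta> * z) * h (\<beta> * z)))"
      using less(1)[OF z] less(1)[OF bz] z \<phi>\<psi>[OF z] inv(2)[OF bz] by (simp add: wcomp_op_def)
    also have "\<dots> = c * h (\<beta> * z)" using mg[OF z] g(2)[OF z] by (simp add: field_simps)
    finally show "?W (?T (?U h)) z = ?V h z" using z by (simp add: wcomp_op_def)
  qed
  have "similar_HolD ?T ?V"
    unfolding similar_HolD_def
    apply (intro conjI wcomp_op_cont_lin[OF m \<phi>(1)] lin_isometry_cont[OF V(1)])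
    apply (rule exI[of _ ?U], rule exI[of _ ?W])
    using U W WU UW WTU by simp
  with V(1) show ?thesis unfolding similar_to_isometry_def by blast
qed

subsection \<open>Automorphisms with bounded orbits\<close>

text \<open>\<open>trace_seq t (Suc n)\<close> is the \<open>n\<close>-th Chebyshev polynomial of
  the second kind at \<open>t / 2\<close>; the recurrence is the Cayley-Hamilton relation for a
  matrix of determinant 1 and trace \<open>t\<close>.\<close>

fun trace_seq :: "real \<Rightarrow> nat \<Rightarrow> real" where
  "trace_seq t 0 = 0"
| "trace_seq t (Suc 0) = 1"
| "trace_seq t (Suc (Suc n)) = t * trace_seq t (Suc n) - trace_seq t n"

text \<open>If the modulus of \<open>t\<close> is at least 2, the recurrence makes the increments of
  the moduli non-decreasing, and the first increment is 1.\<close>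

lemma trace_seq_growth:
  assumes "2 \<le> \<bar>t\<bar>"
  shows "\<bar>trace_seq t n\<bar> + 1 \<le> \<bar>trace_seq t (Suc n)\<bar>"
proof (induction n)
  case (Suc n)
  have "2 * \<bar>trace_seq t (Suc n)\<bar> \<le> \<bar>t * trace_seq t (Suc n)\<bar>"
    using assms by (simp add: abs_mult mult_right_mono)
  also have "\<dots> \<le> \<bar>trace_seq t (Suc (Suc n))\<bar> + \<bar>trace_seq t n\<bar>" by simp
  finally show ?case using Suc by linarith
qed simp

lemma trace_seq_ge:
  assumes "2 \<le> \<bar>t\<bar>" shows "real n \<le> \<bar>trace_seq t n\<bar>"
proof (induction n)
  case (Suc n) then show ?case using trace_seq_growth[OF assms, of n] by simp
qed simp

text \<open>For a matrix \<open>A\<close> of determinant 1 and trace \<open>t\<close>, the left side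
  is the determinant of \<open>trace_seq t (Suc n) * A - trace_seq t n * 1\<close>, which is the
  power of \<open>A\<close> with exponent \<open>Suc n\<close>.\<close>

lemma trace_seq_invariant:
  "(trace_seq t (Suc n))\<^sup>2 - t * trace_seq t (Suc n) * trace_seq t n + (trace_seq t n)\<^sup>2 = 1"
  by (induction n) (simp_all add: power2_eq_square algebra_simps)

text \<open>The \<open>n\<close>-th power of the matrix \<open>A = (p, q; cnj q, cnj p)\<close> of the automorphism is
  \<open>S n * A - S (n-1) * 1\<close>, where \<open>S = trace_seq (tr A)\<close>; this describes the orbit of \<open>0\<close>. If the
  trace is at least \<open>2\<close> in modulus, then \<open>S\<close> is unbounded and the orbit tends to the circle.\<close>
lemma moebius_bounded_orbit_fixed_point:
  fixes p q :: complex
  assumes \<phi>: "\<And>z. cmod z < 1 \<Longrightarrow> \<phi> z = (p * z + q) / (cnj q * z + cnj p)"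
    and det: "(cmod p)\<^sup>2 = 1 + (cmod q)\<^sup>2"
    and r: "r < 1" "\<And>n. cmod ((\<phi> ^^ n) 0) \<le> r"
  shows "\<exists>z. cmod z < 1 \<and> \<phi> z = z"
proof -
  define t where "t = 2 * Re p"
  define S where "S = trace_seq t"
  have tp: "of_real t = p + cnj p" by (simp add: t_def complex_eq_iff)
  have pp: "p * cnj p = 1 + q * cnj q" using det
    by (metis complex_norm_square of_real_1 of_real_add)
  have S: "S 0 = 0" "S (Suc 0) = 1" "S (Suc (Suc n)) = t * S (Suc n) - S n" for n by (auto simp: S_def)
  \<comment> \<open>The lower right entry of the \<open>n\<close>-th power, with
    \<open>S (n-1)\<close> eliminated by the recurrence to avoid subtraction at
    \<open>n = 0\<close>; the upper right entry is \<open>q * S n\<close>.\<close>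
  define y where "y = (\<lambda>n. of_real (S (Suc n)) - p * of_real (S n))"
  \<comment> \<open>This expresses that the \<open>n\<close>-th power has determinant 1.\<close>
  have y: "(cmod (y n))\<^sup>2 = 1 + (cmod q)\<^sup>2 * (S n)\<^sup>2" for n
  proof -
    have "complex_of_real ((cmod (y n))\<^sup>2) = y n * cnj (y n)" by (rule complex_norm_square)
    also have "\<dots> = of_real ((S (Suc n))\<^sup>2) - (p + cnj p) * of_real (S (Suc n) * S n) + p * cnj p * of_real ((S n)\<^sup>2)"
      by (simp add: y_def algebra_simps power2_eq_square)
    also have "\<dots> = of_real ((S (Suc n))\<^sup>2 - t * S (Suc n) * S n + (S n)\<^sup>2) + q * cnj q * of_real ((S n)\<^sup>2)"
      unfolding pp tp[symmetric] by (simp add: algebra_simps)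
    also have "\<dots> = of_real (1 + (cmod q)\<^sup>2 * (S n)\<^sup>2)"
      using trace_seq_invariant[of t n] complex_norm_square[of q] by (simp add: S_def)
    finally show ?thesis using of_real_eq_iff by blast
  qed
  have y0: "y n \<noteq> 0" for n
  proof
    assume "y n = 0"
    then have "1 + (cmod q)\<^sup>2 * (S n)\<^sup>2 = 0" using y[of n] by simp
    moreover have "0 \<le> (cmod q)\<^sup>2 * (S n)\<^sup>2" by simp
    ultimately show False by linarith
  qed
  have orbit: "(\<phi> ^^ n) 0 = q * of_real (S n) / y n" for n
  proof (induction n)
    case (Suc n)
    let ?x = "q * of_real (S n)"
    have "cmod (?x / y n) < 1" using Suc r(1) r(2)[of n] by simp
    then have "(\<phi> ^^ Suc n) 0 = (p * (?x / y n) + q) / (cnj q * (?x / y n) + cnj p)"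
      using \<phi> Suc by simp
    also have "\<dots> = (p * ?x + q * y n) / (cnj q * ?x + cnj p * y n)"
    proof -
      have "p * (?x / y n) + q = (p * ?x + q * y n) / y n"
        "cnj q * (?x / y n) + cnj p = (cnj q * ?x + cnj p * y n) / y n"
        using y0[of n] by (auto simp: add_divide_distrib)
      then show ?thesis using y0[of n] by simp
    qed
    also have "p * ?x + q * y n = q * of_real (S (Suc n))"
      by (simp add: y_def algebra_simps)
    also have "cnj q * ?x + cnj p * y n = y (Suc n)"
    proof -
      have "cnj q * ?x + cnj p * y n = cnj p * of_real (S (Suc n)) - (p * cnj p - q * cnj q) * of_real (S n)"
        by (simp add: y_def algebra_simps)
      also have "\<dots> = cnj p * of_real (S (Suc n)) - of_real (S n)" by (simp add: pp)
      also have "\<dots> = (p + cnj p) * of_real (S (Suc n)) - of_real (S n) - p * of_real (S (Suc n))"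
        by (simp add: algebra_simps)
      also have "\<dots> = y (Suc n)" unfolding tp[symmetric] y_def S(3) by simp
      finally show ?thesis .
    qed
    finally show ?case .
  qed (simp add: S)
  have den: "cnj q * z + cnj p \<noteq> 0" if z: "cmod z < 1" for z
  proof
    assume "cnj q * z + cnj p = 0"
    then have "cnj p = - (cnj q * z)" by (simp add: eq_neg_iff_add_eq_0 add.commute)
    then have "cmod (cnj p) = cmod (cnj q * z)" by (metis norm_minus_cancel)
    then have "cmod p = cmod q * cmod z" by (simp add: norm_mult)
    also have "\<dots> \<le> cmod q" using z by (intro mult_left_le) auto
    finally have "(cmod p)\<^sup>2 \<le> (cmod q)\<^sup>2" by (intro power_mono) auto
    then show False using det by simp
  qed
  show ?thesis
  proof (cases "q = 0")
    case True
    then show ?thesis using \<phi>[of 0] by (intro exI[of _ 0]) simp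
  next
    case q: False
    \<comment> \<open>An orbit confined to radius \<open>r < 1\<close> bounds \<open>S\<close>,
      whereas a trace of modulus at least 2 would give
      \<open>n \<le> \<bar>S n\<bar>\<close>.\<close>
    have "\<bar>t\<bar> < 2"
    proof (rule ccontr)
      assume "\<not> \<bar>t\<bar> < 2"
      then have t: "2 \<le> \<bar>t\<bar>" by simp
      have r0: "0 \<le> r" using r(2)[of 0] by simp
      have r2: "r\<^sup>2 < 1" using r(1) r0 by (simp add: power_less_one_iff abs_square_less_1)
      have bd: "(cmod q)\<^sup>2 * (S n)\<^sup>2 * (1 - r\<^sup>2) \<le> r\<^sup>2" for n
      proof -
        have "cmod q * \<bar>S n\<bar> \<le> r * cmod (y n)"
          using r(2)[of n] y0[of n] unfolding orbit by (simp add: norm_divide norm_mult divide_le_eq)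
        then have "(cmod q * \<bar>S n\<bar>)\<^sup>2 \<le> (r * cmod (y n))\<^sup>2" by (intro power_mono) auto
        then have "(cmod q)\<^sup>2 * (S n)\<^sup>2 \<le> r\<^sup>2 * (1 + (cmod q)\<^sup>2 * (S n)\<^sup>2)"
          by (simp add: power_mult_distrib y)
        then show ?thesis by (simp add: algebra_simps)
      qed
      define C where "C = (cmod q)\<^sup>2 * (1 - r\<^sup>2)"
      have C: "C > 0" using q r2 by (simp add: C_def)
      obtain n :: nat where n: "1 / C < real n" using reals_Archimedean2 by blast
      have n1: "1 \<le> real n" using n C by (cases n) (auto simp: divide_less_0_iff)
      have "1 < C * real n" using n C by (simp add: field_simps)
      also have "\<dots> \<le> C * (real n)\<^sup>2" using C n1 by (simp add: power2_eq_square)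
      also have "\<dots> \<le> C * (S n)\<^sup>2"
        using C trace_seq_ge[OF t, of n] by (simp add: S_def abs_le_square_iff[symmetric])
      also have "\<dots> \<le> r\<^sup>2" using bd[of n] by (simp add: C_def mult_ac)
      finally show False using r2 by simp
    qed
    then have x: "(Re p)\<^sup>2 < 1" by (simp add: t_def abs_square_less_1)
    have p2: "(Re p)\<^sup>2 + (Im p)\<^sup>2 = 1 + (cmod q)\<^sup>2" using det by (simp add: cmod_power2)
    \<comment> \<open>The fixed-point equation
      \<open>cnj q * z\<^sup>2 - (p - cnj p) * z - q = 0\<close> has discriminant
      \<open>- 4 * D\<close>, and \<open>det\<close> gives
      \<open>D = 1 - (Re p)\<^sup>2\<close>.\<close>
    define D where "D = (Im p)\<^sup>2 - (cmod q)\<^sup>2"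
    have D: "0 < D" using x p2 by (simp add: D_def)
    define d where "d = \<bar>Im p\<bar> + sqrt D"
    have qy: "cmod q < \<bar>Im p\<bar>"
      by (rule power2_less_imp_less) (use D in \<open>simp_all add: D_def\<close>)
    have dq: "cmod q < d" using qy real_sqrt_gt_zero[OF D] unfolding d_def by linarith
    then have d0: "d > 0" using norm_ge_zero[of q] by linarith
    have quad: "d\<^sup>2 - 2 * \<bar>Im p\<bar> * d + (cmod q)\<^sup>2 = 0"
    proof -
      have "d\<^sup>2 - 2 * \<bar>Im p\<bar> * d = (sqrt D)\<^sup>2 - (Im p)\<^sup>2" by (simp add: d_def power2_eq_square algebra_simps)
      then show ?thesis using D by (simp add: D_def)
    qed
    define s :: real where "s = (if 0 \<le> Im p then 1 else -1)"
    have s: "s * s = 1" "s * Im p = \<bar>Im p\<bar>" "\<bar>s\<bar> = 1" by (auto simp: s_def)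
    \<comment> \<open>The root of smaller modulus,
      \<open>\<i> * s * (\<bar>Im p\<bar> - sqrt D) / cnj q\<close>, rewritten by means of
      \<open>(\<bar>Im p\<bar> - sqrt D) * d = (cmod q)\<^sup>2\<close>.\<close>
    define z where "z = \<i> * of_real s * q / of_real d"
    have z1: "cmod z < 1" using dq d0 s by (simp add: z_def norm_mult norm_divide)
    have "p * z + q = z * (cnj q * z + cnj p)"
    proof -
      have pc: "p - cnj p = 2 * \<i> * of_real (Im p)" by (simp add: complex_eq_iff)
      have "cnj q * z * z = - (of_real (s * s)) * (cnj q * q) * q / (of_real d)\<^sup>2"
        by (simp add: z_def power2_eq_square field_simps)
      also have "\<dots> = - of_real ((cmod q)\<^sup>2) * q / (of_real d)\<^sup>2"
        using s complex_norm_square[of q] by (simp add: mult.commute)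
      finally have 1: "cnj q * z * z = - of_real ((cmod q)\<^sup>2) * q / (of_real d)\<^sup>2" .
      have "(p - cnj p) * z = - 2 * of_real (s * Im p) * q / of_real d"
        unfolding pc by (simp add: z_def field_simps)
      then have 2: "(p - cnj p) * z = - 2 * of_real \<bar>Im p\<bar> * q / of_real d" by (simp only: s)
      have "p * z + q - z * (cnj q * z + cnj p) = (p - cnj p) * z + q - cnj q * z * z"
        by (simp add: algebra_simps)
      also have "\<dots> = q / (of_real d)\<^sup>2 * of_real (d\<^sup>2 - 2 * \<bar>Im p\<bar> * d + (cmod q)\<^sup>2)"
        unfolding 1 2 using d0 by (simp add: field_simps power2_eq_square)
      also have "\<dots> = 0" unfolding quad by simp
      finally show ?thesis by simp
    qed
    then have "\<phi> z = z" using \<phi>[OF z1] den[OF z1] by simp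
    then show ?thesis using z1 by blast
  qed
qed

text \<open>Solving for the right sides 1 and \<open>z\<close> shows that \<open>m\<close> is
  zero-free and that \<open>z\<close> is determined by \<open>\<phi> z\<close>. If \<phi> omitted a
  value \<open>w\<close>, the right side \<open>m z / (\<phi> z - w)\<close> would have a solution
  \<open>f\<close> with \<open>f u * (u - w) = 1\<close> on the open image, hence also at
  \<open>u = w\<close>.\<close>

lemma surj_wcomp_op_imp_bij:
  assumes m: "m holomorphic_on ball 0 1" and \<phi>: "holo_selfmap \<phi>"
    and surj: "\<And>h. h \<in> HolD \<Longrightarrow> \<exists>f\<in>HolD. wcomp_op m \<phi> f = h"
  shows "bij_betw \<phi> (ball 0 1) (ball 0 1)" "\<And>z. cmod z < 1 \<Longrightarrow> m z \<noteq> 0"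
proof -
  have solve: "\<exists>f\<in>HolD. \<forall>z. cmod z < 1 \<longrightarrow> m z * f (\<phi> z) = h z"
    if h: "h holomorphic_on ball 0 1" for h
  proof -
    obtain f where f: "f \<in> HolD" "wcomp_op m \<phi> f = disc_restrict h" using surj[OF HolD_disc_restrict[OF h]] by blast
    have "m z * f (\<phi> z) = h z" if "cmod z < 1" for z
      using fun_cong[OF f(2), of z] that by (simp add: wcomp_op_def)
    then show ?thesis using f(1) by blast
  qed
  obtain f1 where f1: "\<And>z. cmod z < 1 \<Longrightarrow> m z * f1 (\<phi> z) = 1" using solve[of "\<lambda>_. 1"] by auto
  obtain f2 where f2: "\<And>z. cmod z < 1 \<Longrightarrow> m z * f2 (\<phi> z) = z" using solve[of "\<lambda>z. z"]
    by (auto intro: holomorphic_intros)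
  show m0: "m z \<noteq> 0" if "cmod z < 1" for z using f1[OF that] by auto
  have inj: "inj_on \<phi> (ball 0 1)"
  proof (rule inj_onI)
    fix x y assume xy: "x \<in> ball 0 1" "y \<in> ball (0::complex) 1" "\<phi> x = \<phi> y"
    have "z * f1 (\<phi> z) = f2 (\<phi> z)" if "cmod z < 1" for z
      using f1[OF that] f2[OF that] by (metis mult.assoc mult.commute mult.right_neutral)
    from this[of x] this[of y] have "x * f1 (\<phi> x) = y * f1 (\<phi> x)" using xy by simp
    then show "x = y" using f1[of x] xy by auto
  qed
  have \<phi>h: "\<phi> holomorphic_on ball 0 1" and im: "\<phi> ` ball 0 1 \<subseteq> ball 0 1" using \<phi> by (auto simp: holo_selfmap_def)
  have "ball 0 1 \<subseteq> \<phi> ` ball 0 1"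
  proof
    fix w :: complex assume w: "w \<in> ball 0 1"
    show "w \<in> \<phi> ` ball 0 1"
    proof (rule ccontr)
      assume nw: "w \<notin> \<phi> ` ball 0 1"
      then have "(\<lambda>z. m z / (\<phi> z - w)) holomorphic_on ball 0 1"
        using m \<phi>h by (intro holomorphic_intros) auto
      then obtain f where f: "f \<in> HolD" "\<And>z. cmod z < 1 \<Longrightarrow> m z * f (\<phi> z) = m z / (\<phi> z - w)"
        using solve by blast
      have "f w * (w - w) = 1"
      proof (rule analytic_continuation_open[of "\<phi> ` ball 0 1" "ball 0 1" "\<lambda>u. f u * (u - w)" "\<lambda>_. 1"])
        show "open (\<phi> ` ball 0 1)" using open_mapping_thm3[OF \<phi>h open_ball inj] .
        show "(\<lambda>u. f u * (u - w)) holomorphic_on ball 0 1"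
          by (intro holomorphic_intros HolD_holomorphic f)
        fix u assume "u \<in> \<phi> ` ball 0 1"
        then obtain z where z: "cmod z < 1" "u = \<phi> z" by auto
        then have "\<phi> z \<noteq> w" using nw by auto
        moreover have "f (\<phi> z) = 1 / (\<phi> z - w)"
          by (rule mult_left_cancel[THEN iffD1, OF m0[OF z(1)]]) (use f(2)[OF z(1)] in simp)
        ultimately show "f u * (u - w) = 1" using z by simp
      qed (use im w in auto)
      then show False by simp
    qed
  qed
  then show "bij_betw \<phi> (ball 0 1) (ball 0 1)" using inj im by (auto simp: bij_betw_def)
qed

lemma funpow_less_1: "holo_selfmap \<phi> \<Longrightarrow> cmod z < 1 \<Longrightarrow> cmod ((\<phi> ^^ n) z) < 1"
  by (induction n) (auto intro: holo_selfmap_less)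

lemma wcomp_op_funpow:
  assumes "holo_selfmap \<phi>" "cmod z < 1"
  shows "(wcomp_op m \<phi> ^^ n) h z = (\<Prod>j<n. m ((\<phi> ^^ j) z)) * h ((\<phi> ^^ n) z)"
  using assms(2)
proof (induction n arbitrary: z)
  case (Suc n)
  have "(wcomp_op m \<phi> ^^ Suc n) h z = m z * (wcomp_op m \<phi> ^^ n) h (\<phi> z)"
    using Suc.prems by (simp add: wcomp_op_def)
  also have "\<dots> = m z * ((\<Prod>j<n. m ((\<phi> ^^ j) (\<phi> z))) * h ((\<phi> ^^ n) (\<phi> z)))"
    by (subst Suc.IH[OF holo_selfmap_less[OF assms(1) Suc.prems]]) simp
  also have "\<dots> = (\<Prod>j<Suc n. m ((\<phi> ^^ j) z)) * h ((\<phi> ^^ Suc n) z)"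
    by (simp add: prod.lessThan_Suc_shift funpow_swap1 mult_ac del: funpow.simps prod.lessThan_Suc)
       (simp add: funpow_swap1 mult_ac)
  finally show ?case .
qed simp

text \<open>The bound is tested on the functions \<open>z ^ k\<close> with \<open>k \<rightarrow> \<infinity>\<close>.\<close>
lemma orbit_bounded_if_powers_bounded:
  assumes \<phi>: "holo_selfmap \<phi>" and m0: "\<And>z. cmod z < 1 \<Longrightarrow> m z \<noteq> 0"
    and q: "0 < q" and bd: "\<And>n h. h \<in> HolD \<Longrightarrow> cmod ((wcomp_op m \<phi> ^^ n) h 0) \<le> C * hol_seminorm q h"
    and C: "0 < C"
  obtains r where "r < 1" "\<And>n. cmod ((\<phi> ^^ n) 0) \<le> r"
proof -
  \<comment> \<open>The maximum with 1/2 keeps \<open>r\<close> positive when \<open>q = 1\<close>,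
    where the closed disc is the single point 0; \<open>r\<close> is a divisor below.\<close>
  define r where "r = max (1/2) (1 - 1 / real q)"
  have r: "0 < r" "r < 1" using q by (auto simp: r_def)
  have "cmod ((\<phi> ^^ n) 0) \<le> r" for n
  proof (rule ccontr)
    define w where "w = (\<phi> ^^ n) 0"
    \<comment> \<open>No control of \<open>M\<close> in terms of \<open>n\<close> is needed: with
      \<open>n\<close> fixed, the growing exponent \<open>k\<close> outweighs any nonzero
      \<open>M\<close>.\<close>
    define M where "M = (\<Prod>j<n. m ((\<phi> ^^ j) 0))"
    assume "\<not> cmod ((\<phi> ^^ n) 0) \<le> r"
    then have w: "r < cmod w" by (simp add: w_def)
    have w1: "cmod w < 1" unfolding w_def by (rule funpow_less_1[OF \<phi>]) simp
    have M: "M \<noteq> 0" unfolding M_def using m0 funpow_less_1[OF \<phi>, of 0] by auto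
    have bound: "cmod M * cmod w ^ k \<le> C * r ^ k" for k
    proof -
      let ?h = "disc_restrict (\<lambda>z. z ^ k)"
      have h: "?h \<in> HolD" by (intro HolD_disc_restrict holomorphic_intros)
      have "hol_seminorm q ?h \<le> r ^ k"
      proof (rule seminorm_le[OF q])
        fix z :: complex assume z: "cmod z \<le> 1 - 1 / real q"
        then have "cmod z \<le> r" by (simp add: r_def)
        then show "cmod (?h z) \<le> r ^ k" using r by (auto simp: disc_restrict_def norm_power intro: power_mono)
      qed
      then have "C * hol_seminorm q ?h \<le> C * r ^ k" using C by simp
      moreover have "(wcomp_op m \<phi> ^^ n) ?h 0 = M * w ^ k"
        using wcomp_op_funpow[OF \<phi>, of 0 n m ?h] w1 by (simp add: M_def w_def)
      ultimately show ?thesis using bd[OF h, of n] by (simp add: norm_mult norm_power)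
    qed
    obtain k where "C / cmod M < (cmod w / r) ^ k"
      using real_arch_pow[of "cmod w / r" "C / cmod M"] w r by auto
    then have "C * r ^ k < cmod M * cmod w ^ k" using r M by (simp add: field_simps power_divide)
    then show False using bound[of k] by simp
  qed
  then show ?thesis using that r by blast
qed

text \<open>If \<open>a\<close> is the zero of \<phi>, then
  \<open>\<phi> z = \<beta> * (z - a) / (1 - cnj a * z)\<close>. A square root of \<beta>, split
  between numerator and denominator, makes the matrix conjugate-symmetric; division by
  \<open>sqrt (1 - (cmod a)\<^sup>2)\<close> makes its determinant 1.\<close>

lemma automorphism_moebius_form:
  assumes \<phi>: "holo_selfmap \<phi>" "bij_betw \<phi> (ball 0 1) (ball 0 1)"
  obtains p q where "(cmod p)\<^sup>2 = 1 + (cmod q)\<^sup>2"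
    "\<And>z. cmod z < 1 \<Longrightarrow> \<phi> z = (p * z + q) / (cnj q * z + cnj p)"
proof -
  have "0 \<in> \<phi> ` ball 0 1" using \<phi>(2) by (simp add: bij_betw_def)
  then obtain a where a: "cmod a < 1" "\<phi> a = 0" by force
  obtain \<eta> where \<eta>: "holo_selfmap \<eta>" "\<And>z. cmod z < 1 \<Longrightarrow> \<eta> (\<phi> z) = z"
    using holo_selfmap_inverse[OF \<phi>] by blast
  let ?\<psi> = "Moebius_function 0 (- a)" and ?\<kappa> = "Moebius_function 0 a"
  have s: "holo_selfmap ?\<psi>" "holo_selfmap ?\<kappa>"
    using a Moebius_function_holomorphic[of a 0] Moebius_function_holomorphic[of "- a" 0]
      Moebius_function_norm_lt_1[of a] Moebius_function_norm_lt_1[of "- a"]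
    by (auto simp: holo_selfmap_def)
  have inv: "?\<psi> (?\<kappa> z) = z" "?\<kappa> (?\<psi> z) = z" if "cmod z < 1" for z
    using a that by (auto intro: Moebius_function_compose)
  have 1: "holo_selfmap (\<lambda>z. \<phi> (?\<psi> z))" by (rule holo_selfmap_comp[OF \<phi>(1) s(1)])
  have 2: "holo_selfmap (\<lambda>z. ?\<kappa> (\<eta> z))" by (rule holo_selfmap_comp[OF s(2) \<eta>(1)])
  have 3: "\<phi> (?\<psi> 0) = 0" using a by (simp add: Moebius_function_of_zero)
  have 4: "?\<kappa> (\<eta> (\<phi> (?\<psi> z))) = z" if z: "cmod z < 1" for z
    using \<eta>(2)[OF holo_selfmap_less[OF s(1) z]] inv(2)[OF z] by simp
  obtain \<beta> where \<beta>: "cmod \<beta> = 1" "\<And>z. cmod z < 1 \<Longrightarrow> \<phi> (?\<psi> z) = \<beta> * z"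
    using automorphism_fixing_0_rotation[of "\<lambda>z. \<phi> (?\<psi> z)" "\<lambda>z. ?\<kappa> (\<eta> z)", OF 1 3 2 4] by blast
  define e where "e = csqrt \<beta>"
  have e: "e * e = \<beta>" "cmod e = 1" using \<beta>(1) power2_csqrt[of \<beta>] by (simp_all add: e_def power2_eq_square)
  have ee: "e * cnj e = 1" using complex_norm_square[of e] e(2) by simp
  then have e0: "cnj e \<noteq> 0" "e \<noteq> 0" by auto
  define s where "s = sqrt (1 - (cmod a)\<^sup>2)"
  have s2: "s\<^sup>2 = 1 - (cmod a)\<^sup>2" using a(1) by (simp add: s_def power_le_one)
  have "(cmod a)\<^sup>2 < 1" using a(1) by (simp add: abs_square_less_1)
  then have s0: "s > 0" by (simp add: s_def)
  define p q where "p = e / of_real s" and "q = - (e * a) / of_real s"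
  have "(cmod p)\<^sup>2 = 1 / s\<^sup>2" "(cmod q)\<^sup>2 = (cmod a)\<^sup>2 / s\<^sup>2"
    using s0 e(2) by (simp_all add: p_def q_def norm_mult norm_divide power_divide)
  moreover have "1 / s\<^sup>2 = s\<^sup>2 / s\<^sup>2 + (cmod a)\<^sup>2 / s\<^sup>2"
    unfolding add_divide_distrib[symmetric] using s2 by simp
  ultimately have "(cmod p)\<^sup>2 = 1 + (cmod q)\<^sup>2" using s0 by simp
  moreover have "\<phi> z = (p * z + q) / (cnj q * z + cnj p)" if z: "cmod z < 1" for z
  proof -
    have "\<phi> z = \<beta> * ?\<kappa> z" using \<beta>(2)[OF holo_selfmap_less[OF s(2) z]] inv(1)[OF z] by simp
    also have "\<dots> = e * (z - a) / (cnj e * (1 - cnj a * z))"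
    proof -
      have "\<beta> = e / cnj e" using e(1) ee e0 by (metis eq_divide_imp mult.assoc mult.right_neutral)
      then show ?thesis by (simp add: Moebius_function_simple)
    qed
    also have "\<dots> = (e * (z - a) / of_real s) / (cnj e * (1 - cnj a * z) / of_real s)" using s0 by simp
    also have "e * (z - a) / of_real s = p * z + q" using s0 by (simp add: p_def q_def field_simps)
    also have "cnj e * (1 - cnj a * z) / of_real s = cnj q * z + cnj p"
      using s0 by (simp add: p_def q_def field_simps)
    finally show ?thesis .
  qed
  ultimately show ?thesis by (rule that)
qed

subsection \<open>Operators similar to an isometry\<close>

lemma similar_to_isometry_structure:
  assumes "similar_to_isometry T"
  obtains \<alpha> \<beta> U V W where "cmod \<alpha> = 1" "cmod \<beta> = 1" "lin_isometry_HolD V"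
    "cont_lin_HolD U" "cont_lin_HolD W"
    "\<And>f. f \<in> HolD \<Longrightarrow> W (U f) = f" "\<And>f. f \<in> HolD \<Longrightarrow> U (W f) = f"
    "\<And>f. f \<in> HolD \<Longrightarrow> T f = U (V (W f))"
    "\<And>f z. f \<in> HolD \<Longrightarrow> cmod z < 1 \<Longrightarrow> V f z = \<alpha> * f (\<beta> * z)"
proof -
  obtain V U W where V: "lin_isometry_HolD V" and T: "cont_lin_HolD T" and U: "cont_lin_HolD U" and W: "cont_lin_HolD W"
    and inv: "\<And>f. f \<in> HolD \<Longrightarrow> W (U f) = f" "\<And>f. f \<in> HolD \<Longrightarrow> U (W f) = f"
    and WTU: "\<And>f. f \<in> HolD \<Longrightarrow> W (T (U f)) = V f"
    using assms unfolding similar_to_isometry_def similar_HolD_def by auto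
  have H: "T f \<in> HolD" "W f \<in> HolD" if "f \<in> HolD" for f
    using T W linear_on_HolD_D(1) that unfolding cont_lin_HolD_def by auto
  have TU: "T f = U (V (W f))" if f: "f \<in> HolD" for f
    using WTU[OF H(2)[OF f]] inv(2)[OF f] inv(2)[OF H(1)[OF f]] by simp
  obtain \<alpha> \<beta> where "cmod \<alpha> = 1" "cmod \<beta> = 1" "\<And>f z. f \<in> HolD \<Longrightarrow> cmod z < 1 \<Longrightarrow> V f z = \<alpha> * f (\<beta> * z)"
    using lin_isometry_form[OF V] by metis
  then show ?thesis using that V U W inv TU by blast
qed

lemma similar_to_isometry_surj:
  assumes "similar_to_isometry T" "h \<in> HolD"
  shows "\<exists>f\<in>HolD. T f = h"
proof -
  obtain \<alpha> \<beta> U V W where ab: "cmod \<alpha> = 1" "cmod \<beta> = 1" and V: "lin_isometry_HolD V"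
    and UW: "cont_lin_HolD U" "cont_lin_HolD W"
    and inv: "\<And>f. f \<in> HolD \<Longrightarrow> W (U f) = f" "\<And>f. f \<in> HolD \<Longrightarrow> U (W f) = f"
    and T: "\<And>f. f \<in> HolD \<Longrightarrow> T f = U (V (W f))"
    and Vf: "\<And>f z. f \<in> HolD \<Longrightarrow> cmod z < 1 \<Longrightarrow> V f z = \<alpha> * f (\<beta> * z)"
    using similar_to_isometry_structure[OF assms(1)] by metis
  have lin: "linear_on_HolD U" "linear_on_HolD V" "linear_on_HolD W"
    using V UW by (auto simp: lin_isometry_HolD_def cont_lin_HolD_def)
  note H = lin[THEN linear_on_HolD_D(1)]
  have Wh: "W h \<in> HolD" by (rule H(3)[OF assms(2)])
  have ab0: "\<alpha> \<noteq> 0" "\<beta> \<noteq> 0" using ab by auto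
  \<comment> \<open>The preimage of \<open>W h\<close> under \<open>V\<close>, found by undoing the
    rotation and the factor; \<open>U\<close> carries it to a preimage of \<open>h\<close> under
    \<open>T\<close>.\<close>
  let ?k = "disc_restrict (\<lambda>z. inverse \<alpha> * W h (inverse \<beta> * z))"
  have "(\<lambda>z. W h (inverse \<beta> * z)) holomorphic_on ball 0 1"
    by (rule holomorphic_rotate[OF HolD_holomorphic[OF Wh]]) (simp add: norm_inverse ab)
  then have k: "?k \<in> HolD" by (intro HolD_disc_restrict holomorphic_intros)
  have "V ?k = W h"
  proof (rule HolD_eqI[OF H(2)[OF k] Wh])
    fix z :: complex assume z: "cmod z < 1"
    then have "cmod (\<beta> * z) < 1" using ab by (simp add: norm_mult)
    then show "V ?k z = W h z" using Vf[OF k z] ab0 by (simp add: mult.assoc[symmetric])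
  qed
  then have "T (U ?k) = h" using T[OF H(1)[OF k]] inv(1)[OF k] inv(2)[OF assms(2)] by simp
  then show ?thesis using H(1)[OF k] by blast
qed

text \<open>The constant 1 is invariant under rotations, hence an eigenfunction of \<open>V\<close>;
  the injective \<open>U\<close> carries it to one of \<open>T\<close>.\<close>

lemma similar_to_isometry_eigenvalue:
  assumes "similar_to_isometry T"
  shows "point_spectrum T \<inter> sphere 0 1 \<noteq> {}"
proof -
  obtain \<alpha> \<beta> U V W where ab: "cmod \<alpha> = 1" "cmod \<beta> = 1" and V: "lin_isometry_HolD V"
    and UW: "cont_lin_HolD U" "cont_lin_HolD W"
    and inv: "\<And>f. f \<in> HolD \<Longrightarrow> W (U f) = f" "\<And>f. f \<in> HolD \<Longrightarrow> U (W f) = f"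
    and T: "\<And>f. f \<in> HolD \<Longrightarrow> T f = U (V (W f))"
    and Vf: "\<And>f z. f \<in> HolD \<Longrightarrow> cmod z < 1 \<Longrightarrow> V f z = \<alpha> * f (\<beta> * z)"
    using similar_to_isometry_structure[OF assms(1)] by metis
  have lin: "linear_on_HolD U" "linear_on_HolD V" "linear_on_HolD W"
    using V UW by (auto simp: lin_isometry_HolD_def cont_lin_HolD_def)
  note H = lin[THEN linear_on_HolD_D(1)]
  let ?o = "disc_restrict (\<lambda>_. 1)"
  have o: "?o \<in> HolD" by (intro HolD_disc_restrict) auto
  have "V ?o = (\<lambda>z. \<alpha> * ?o z)"
  proof (rule HolD_eqI[OF H(2)[OF o] HolD_cmult[OF o]])
    fix z :: complex assume z: "cmod z < 1"
    then have "cmod (\<beta> * z) < 1" using ab by (simp add: norm_mult)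
    then show "V ?o z = \<alpha> * ?o z" using Vf[OF o z] z by simp
  qed
  then have "T (U ?o) = (\<lambda>z. \<alpha> * U ?o z)"
    using T[OF H(1)[OF o]] inv(1)[OF o] linear_on_HolD_D(3)[OF lin(1) o] by simp
  moreover have "U ?o \<noteq> (\<lambda>_. 0)"
  proof
    assume "U ?o = (\<lambda>_. 0)"
    then have "?o = (\<lambda>_. 0)" using inv(1)[OF o] linear_on_HolD_D(5)[OF lin(3)] by simp
    from fun_cong[OF this, of 0] show False by simp
  qed
  ultimately have "\<alpha> \<in> point_spectrum T" using H(1)[OF o] unfolding point_spectrum_def by blast
  then show ?thesis using ab by (auto simp: disjoint_iff)
qed

text \<open>The powers are \<open>U V^n W\<close>, and \<open>V^n\<close> preserves the seminorm
  that links the bounds for \<open>U\<close> and \<open>W\<close>, so the constants are uniform in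
  \<open>n\<close>.\<close>

lemma similar_to_isometry_power_bounded:
  assumes "similar_to_isometry T" "0 < p"
  obtains q C where "0 < q" "0 < C"
    "\<And>n f. f \<in> HolD \<Longrightarrow> hol_seminorm p ((T ^^ n) f) \<le> C * hol_seminorm q f"
proof -
  obtain \<alpha> \<beta> U V W where V: "lin_isometry_HolD V"
    and UW: "cont_lin_HolD U" "cont_lin_HolD W"
    and inv: "\<And>f. f \<in> HolD \<Longrightarrow> W (U f) = f" "\<And>f. f \<in> HolD \<Longrightarrow> U (W f) = f"
    and T: "\<And>f. f \<in> HolD \<Longrightarrow> T f = U (V (W f))"
    using similar_to_isometry_structure[OF assms(1)] by metis
  have lin: "linear_on_HolD U" "linear_on_HolD V" "linear_on_HolD W"
    using V UW by (auto simp: lin_isometry_HolD_def cont_lin_HolD_def)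
  note H = lin[THEN linear_on_HolD_D(1)]
  obtain p1 C1 where 1: "0 < p1" "0 < C1" "\<And>f. f \<in> HolD \<Longrightarrow> hol_seminorm p (U f) \<le> C1 * hol_seminorm p1 f"
    using cont_lin_HolD_bound[OF UW(1) assms(2)] by metis
  obtain q C2 where 2: "0 < q" "0 < C2" "\<And>f. f \<in> HolD \<Longrightarrow> hol_seminorm p1 (W f) \<le> C2 * hol_seminorm q f"
    using cont_lin_HolD_bound[OF UW(2) 1(1)] by metis
  have Vn: "(V ^^ n) f \<in> HolD \<and> hol_seminorm p1 ((V ^^ n) f) = hol_seminorm p1 f" if "f \<in> HolD" for n f
    using that by (induction n) (auto simp: H(2) lin_isometry_seminorm[OF V _ 1(1)])
  have Tn: "(T ^^ n) f = U ((V ^^ n) (W f))" if f: "f \<in> HolD" for n f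
  proof (induction n)
    case (Suc n)
    have "(V ^^ n) (W f) \<in> HolD" using Vn[OF H(3)[OF f]] by blast
    then show ?case using Suc T[OF H(1)] inv(1) by simp
  qed (use inv f in simp)
  have "hol_seminorm p ((T ^^ n) f) \<le> C1 * C2 * hol_seminorm q f" if f: "f \<in> HolD" for n f
  proof -
    have "hol_seminorm p ((T ^^ n) f) \<le> C1 * hol_seminorm p1 (W f)"
      unfolding Tn[OF f] using 1(3)[of "(V ^^ n) (W f)"] Vn[OF H(3)[OF f], of n] by simp
    also have "\<dots> \<le> C1 * (C2 * hol_seminorm q f)" using 2(3)[OF f] 1(2) by (intro mult_left_mono) auto
    finally show ?thesis by (simp add: mult.assoc)
  qed
  then show ?thesis using that[of q "C1 * C2"] 1 2 by simp
qed

section \<open>Weighted composition operators similar to an isometry\<close>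

lemma wcomp_op_funpow_HolD:
  assumes "m holomorphic_on ball 0 1" "holo_selfmap \<phi>" "h \<in> HolD"
  shows "(wcomp_op m \<phi> ^^ n) h \<in> HolD"
  by (induction n) (simp_all add: assms wcomp_op_HolD)

lemma similar_to_isometry_wcomp_op:
  assumes m: "m holomorphic_on ball 0 1" and \<phi>: "holo_selfmap \<phi>"
    and sim: "similar_to_isometry (wcomp_op m \<phi>)"
  shows "bij_betw \<phi> (ball 0 1) (ball 0 1)" "elliptic \<phi>"
proof -
  note surj = similar_to_isometry_surj[OF sim]
  show bij: "bij_betw \<phi> (ball 0 1) (ball 0 1)" by (rule surj_wcomp_op_imp_bij(1)[OF m \<phi> surj])
  have m0: "m z \<noteq> 0" if "cmod z < 1" for z
    by (rule surj_wcomp_op_imp_bij(2)[OF m \<phi> surj that])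
  \<comment> \<open>Seminorm 1 is the modulus at 0, which is all that the orbit of 0
    requires.\<close>
  obtain q C where qC: "0 < q" "0 < C"
    "\<And>n f. f \<in> HolD \<Longrightarrow> hol_seminorm 1 ((wcomp_op m \<phi> ^^ n) f) \<le> C * hol_seminorm q f"
    using similar_to_isometry_power_bounded[OF sim, of 1] by auto
  have "cmod ((wcomp_op m \<phi> ^^ n) h 0) \<le> C * hol_seminorm q h" if h: "h \<in> HolD" for n h
    using seminorm_ge[OF wcomp_op_funpow_HolD[OF m \<phi> h], of 1 0 n] qC(3)[OF h, of n] by simp
  then obtain r where r: "r < 1" "\<And>n. cmod ((\<phi> ^^ n) 0) \<le> r"
    using orbit_bounded_if_powers_bounded[where m = m, OF \<phi> m0 qC(1) _ qC(2)] by blast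
  obtain p q where pq: "(cmod p)\<^sup>2 = 1 + (cmod q)\<^sup>2"
    "\<And>z. cmod z < 1 \<Longrightarrow> \<phi> z = (p * z + q) / (cnj q * z + cnj p)"
    using automorphism_moebius_form[OF \<phi> bij] by blast
  show "elliptic \<phi>"
    using moebius_bounded_orbit_fixed_point[OF pq(2,1) r] by (auto simp: elliptic_def)
qed

lemma similar_to_isometry_wcomp_op_iff:
  assumes "m holomorphic_on ball 0 1" "holo_selfmap \<phi>"
  shows "similar_to_isometry (wcomp_op m \<phi>) \<longleftrightarrow> bij_betw \<phi> (ball 0 1) (ball 0 1) \<and> elliptic \<phi> \<and>
    point_spectrum (wcomp_op m \<phi>) \<inter> sphere 0 1 \<noteq> {}"
  using similar_to_isometry_wcomp_op[OF assms] similar_to_isometry_eigenvalue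
    wcomp_op_similar_to_isometry[OF assms] by blast

section \<open>Composition and multiplication operators as special cases\<close>

lemma point_spectrum_if_one_eigenfunction:
  assumes "T (disc_restrict (\<lambda>_. 1)) = (\<lambda>z. c * disc_restrict (\<lambda>_. 1) z)"
  shows "c \<in> point_spectrum T"
proof -
  have "disc_restrict (\<lambda>_. 1) \<in> HolD" by (intro HolD_disc_restrict) auto
  moreover have "disc_restrict (\<lambda>_. 1) \<noteq> (\<lambda>_. 0)"
  proof
    assume "disc_restrict (\<lambda>_. 1) = (\<lambda>_. 0)"
    from fun_cong[OF this, of 0] show False by simp
  qed
  ultimately show ?thesis using assms unfolding point_spectrum_def by blast
qed

text \<open>Off the zeros of \<open>f\<close> the equation can be divided by \<open>f\<close>; this
  set is open and non-empty, so the identity theorem applies.\<close>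

lemma eigenvalue_mult_op:
  assumes m: "m holomorphic_on ball 0 1" and f: "f \<in> HolD" "f \<noteq> (\<lambda>_. 0)" and eq: "mult_op m f = (\<lambda>z. c * f z)"
    and z: "cmod z < 1"
  shows "m z = c"
proof (rule analytic_continuation_open[of "ball 0 1 \<inter> f -` (- {0})" "ball 0 1" m "\<lambda>_. c"])
  show "open (ball 0 1 \<inter> f -` (- {0}))"
    by (intro continuous_open_preimage holomorphic_on_imp_continuous_on HolD_holomorphic f) auto
  obtain w where "cmod w < 1" "f w \<noteq> 0" using f HolD_eqI[OF f(1) HolD_zero] by blast
  then have "w \<in> ball 0 1 \<inter> f -` (- {0})" by simp
  then show "ball 0 1 \<inter> f -` (- {0}) \<noteq> {}" by blast
  fix u assume u: "u \<in> ball 0 1 \<inter> f -` (- {0})"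
  then show "m u = c" using fun_cong[OF eq, of u] by (simp add: mult_op_def)
qed (use m z in auto)

theorem theorem3p2:
  shows "(\<forall>\<phi>. holo_selfmap \<phi> \<longrightarrow>
            (similar_to_isometry (comp_op \<phi>) \<longleftrightarrow>
               bij_betw \<phi> (ball 0 1) (ball 0 1) \<and> elliptic \<phi>))
       \<and> (\<forall>m. m holomorphic_on ball 0 1 \<longrightarrow>
            (similar_to_isometry (mult_op m) \<longleftrightarrow>
               (\<exists>c. cmod c = 1 \<and> (\<forall>z\<in>ball 0 1. m z = c))))
       \<and> (\<forall>m \<phi>. m holomorphic_on ball 0 1 \<longrightarrow> holo_selfmap \<phi> \<longrightarrow>
            (similar_to_isometry (wcomp_op m \<phi>) \<longleftrightarrow>
               bij_betw \<phi> (ball 0 1) (ball 0 1) \<and> elliptic \<phi> \<and>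
               point_spectrum (wcomp_op m \<phi>) \<inter> sphere 0 1 \<noteq> {}))"
proof (intro conjI allI impI)
  let ?o = "disc_restrict (\<lambda>_. 1)"
  fix \<phi> assume \<phi>: "holo_selfmap \<phi>"
  \<comment> \<open>Composition fixes the constant 1, so the spectral condition holds
    automatically.\<close>
  have "wcomp_op (\<lambda>_. 1) \<phi> ?o = (\<lambda>z. 1 * ?o z)"
    using holo_selfmap_less[OF \<phi>] by (auto simp: wcomp_op_def disc_restrict_def)
  then have "1 \<in> point_spectrum (wcomp_op (\<lambda>_. 1) \<phi>)"
    by (rule point_spectrum_if_one_eigenfunction)
  moreover have "comp_op \<phi> = wcomp_op (\<lambda>_. 1) \<phi>" by (simp add: comp_op_def wcomp_op_def fun_eq_iff)
  ultimately show "similar_to_isometry (comp_op \<phi>) \<longleftrightarrow> bij_betw \<phi> (ball 0 1) (ball 0 1) \<and> elliptic \<phi>"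
    using similar_to_isometry_wcomp_op_iff[OF _ \<phi>, of "\<lambda>_. 1"] by (auto simp: disjoint_iff)
next
  let ?o = "disc_restrict (\<lambda>_. 1)"
  fix m :: "complex \<Rightarrow> complex" assume m: "m holomorphic_on ball 0 1"
  have id: "holo_selfmap (\<lambda>z. z)" by (auto simp: holo_selfmap_def intro: holomorphic_intros)
  \<comment> \<open>The identity is an elliptic automorphism, so only the spectral condition
    remains.\<close>
  have "elliptic (\<lambda>z. z)" unfolding elliptic_def by (rule bexI[of _ 0]) simp_all
  moreover have "bij_betw (\<lambda>z. z) (ball 0 1) (ball (0::complex) 1)" by (simp add: bij_betw_def inj_on_def)
  moreover have "mult_op m = wcomp_op m (\<lambda>z. z)" by (simp add: mult_op_def wcomp_op_def fun_eq_iff)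
  ultimately have "similar_to_isometry (mult_op m) \<longleftrightarrow> point_spectrum (mult_op m) \<inter> sphere 0 1 \<noteq> {}"
    using similar_to_isometry_wcomp_op_iff[OF m id] by simp
  also have "\<dots> \<longleftrightarrow> (\<exists>c. cmod c = 1 \<and> (\<forall>z\<in>ball 0 1. m z = c))"
  proof
    assume "point_spectrum (mult_op m) \<inter> sphere 0 1 \<noteq> {}"
    then obtain c where "c \<in> point_spectrum (mult_op m)" and c: "cmod c = 1" by auto
    then obtain f where f: "f \<in> HolD" "f \<noteq> (\<lambda>_. 0)" "mult_op m f = (\<lambda>z. c * f z)"
      unfolding point_spectrum_def by blast
    show "\<exists>c. cmod c = 1 \<and> (\<forall>z\<in>ball 0 1. m z = c)"
      using c eigenvalue_mult_op[OF m f] by auto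
  next
    assume "\<exists>c. cmod c = 1 \<and> (\<forall>z\<in>ball 0 1. m z = c)"
    then obtain c where c: "cmod c = 1" "\<And>z. cmod z < 1 \<Longrightarrow> m z = c" by auto
    have "mult_op m ?o = (\<lambda>z. c * ?o z)" using c(2) by (auto simp: mult_op_def disc_restrict_def)
    then have "c \<in> point_spectrum (mult_op m)"
      by (rule point_spectrum_if_one_eigenfunction)
    then show "point_spectrum (mult_op m) \<inter> sphere 0 1 \<noteq> {}" using c by (auto simp: disjoint_iff)
  qed
  finally show "similar_to_isometry (mult_op m) \<longleftrightarrow> (\<exists>c. cmod c = 1 \<and> (\<forall>z\<in>ball 0 1. m z = c))" .
next
  fix m \<phi> :: "complex \<Rightarrow> complex" assume "m holomorphic_on ball 0 1" "holo_selfmap \<phi>"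
  then show "similar_to_isometry (wcomp_op m \<phi>) \<longleftrightarrow>
               bij_betw \<phi> (ball 0 1) (ball 0 1) \<and> elliptic \<phi> \<and>
               point_spectrum (wcomp_op m \<phi>) \<inter> sphere 0 1 \<noteq> {}"
    by (rule similar_to_isometry_wcomp_op_iff)
qed

end
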